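(* Let $\Gamma$ be a group of automorphisms of the graph $\mathbb Z$ acting transitively on $\mathbb Z$, let $S$ be a finite or countable set, and let $X=(X_i)_{i\in\mathbb Z}$ be an $S$-valued, $\Gamma$-invariant, $1$-dependent random field on $\mathbb Z$. Then $X$ is a finitary $\Gamma$-factor of an i.i.d. process with a coding radius $R$ satisfying $\mathbb P(R>r)\le 8/r$ for all integers $r\ge 1$.
   Context: $\mathbb Z$ is regarded as a graph with edges between consecutive integers. A random field $X$ is $\Gamma$-invariant if $(X_{\gamma i})_{i\in\mathbb Z}$ has the same distribution as $X$ for every $\gamma\in\Gamma$. It is $1$-dependent if $(X_i)_{i\in U}$ and $(X_j)_{j\in V}$ are independent for any $U,V\subset\mathbb Z$ with $|i-j|>1$ for all $i\in U$, $j\in V$. An i.i.d. process is a field $Y=(Y_i)_{i\in\mathbb Z}$ of independent identically distributed variables, taking values in a space $T$ which is finite, countable, or of the form $T_1\times T_2\times\cdots$ with each $T_i$ finite. A coding from $Y$ to $X$ is a measurable $\varphi:T^{\mathbb Z}\to S^{\mathbb Z}$ that commutes with the action of every element of $\Gamma$ and such that $\varphi(Y)$ has the same distribution as $X$. For $T$ at most countable, the coding radius $R(y)$ is the minimal integer $r\ge0$ such that $\varphi(y')_0=\varphi(y)_0$ for all $y'$ with $y'_v=y_v$ for all $|v|\le r$ ($\infty$ if none exists). For $T=T_1\times T_2\times\cdots$, $R(y)$ is the smallest $r$ for which there exists $n$ such that $\varphi(y')_0=\varphi(y)_0$ for all $y'$ with $y'_{v,i}=y_{v,i}$ for all $|v|\le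 r$ and $1\le i\le n$. Write $R=R(Y)$. The coding is finitary if $R<\infty$ almost surely; $X$ is a finitary $\Gamma$-factor of $Y$ if a finitary coding exists. *)

theory Defs
  imports "HOL-Probability.Probability" "HOL-Algebra.Bij" "HOL-Library.Extended_Nat"
begin

definition int_adj :: "int \<Rightarrow> int \<Rightarrow> bool" where
  "int_adj i j \<longleftrightarrow> \<bar>i - j\<bar> = 1"

definition graph_automorphism :: "(int \<Rightarrow> int) \<Rightarrow> bool" where
  "graph_automorphism \<gamma> \<longleftrightarrow> bij \<gamma> \<and> (\<forall>i j. int_adj (\<gamma> i) (\<gamma> j) \<longleftrightarrow> int_adj i j)"

definition automorphism_group :: "(int \<Rightarrow> int) set \<Rightarrow> bool" where
  "automorphism_group \<Gamma> \<longleftrightarrow>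
     subgroup \<Gamma> (BijGroup (UNIV :: int set)) \<and> (\<forall>\<gamma>\<in>\<Gamma>. graph_automorphism \<gamma>)"

definition acts_transitively :: "(int \<Rightarrow> int) set \<Rightarrow> bool" where
  "acts_transitively \<Gamma> \<longleftrightarrow> (\<forall>i j. \<exists>\<gamma>\<in>\<Gamma>. \<gamma> i = j)"

text \<open>Fields take their values in a measurable space; only the space and the sigma-algebra of the
  ``measure'' \<open>A\<close> below matter.  A countable set \<open>S\<close> enters as \<open>count_space S\<close>.\<close>

abbreviation configs :: "'a measure \<Rightarrow> (int \<Rightarrow> 'a) measure" where
  "configs A \<equiv> Pi\<^sub>M (UNIV :: int set) (\<lambda>_. A)"

definition random_field :: "'w measure \<Rightarrow> 'a measure \<Rightarrow> (int \<Rightarrow> 'w \<Rightarrow> 'a) \<Rightarrow> bool" where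
  "random_field M A X \<longleftrightarrow> prob_space M \<and> (\<forall>i. X i \<in> measurable M A)"

definition field_law :: "'w measure \<Rightarrow> 'a measure \<Rightarrow> (int \<Rightarrow> 'w \<Rightarrow> 'a) \<Rightarrow> (int \<Rightarrow> 'a) measure" where
  "field_law M A X = distr M (configs A) (\<lambda>\<omega> i. X i \<omega>)"

definition invariant_field ::
  "(int \<Rightarrow> int) set \<Rightarrow> 'w measure \<Rightarrow> 'a measure \<Rightarrow> (int \<Rightarrow> 'w \<Rightarrow> 'a) \<Rightarrow> bool" where
  "invariant_field \<Gamma> M A X \<longleftrightarrow> (\<forall>\<gamma>\<in>\<Gamma>. field_law M A (\<lambda>i. X (\<gamma> i)) = field_law M A X)"

definition one_dependent :: "'w measure \<Rightarrow> 'a measure \<Rightarrow> (int \<Rightarrow> 'w \<Rightarrow> 'a) \<Rightarrow> bool" where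
  "one_dependent M A X \<longleftrightarrow>
     (\<forall>U V. (\<forall>i\<in>U. \<forall>j\<in>V. \<bar>i - j\<bar> > 1) \<longrightarrow>
        prob_space.indep_var M
          (Pi\<^sub>M U (\<lambda>_. A)) (\<lambda>\<omega>. \<lambda>i\<in>U. X i \<omega>)
          (Pi\<^sub>M V (\<lambda>_. A)) (\<lambda>\<omega>. \<lambda>j\<in>V. X j \<omega>))"

definition iid_process :: "'w measure \<Rightarrow> 't measure \<Rightarrow> (int \<Rightarrow> 'w \<Rightarrow> 't) \<Rightarrow> bool" where
  "iid_process N T Y \<longleftrightarrow>
     random_field N T Y \<and> prob_space.indep_vars N (\<lambda>_. T) Y UNIV \<and>
     (\<forall>i j. distr N T (Y i) = distr N T (Y j))"

definition is_coding ::
  "(int \<Rightarrow> int) set \<Rightarrow> 'v measure \<Rightarrow> 't measure \<Rightarrow> (int \<Rightarrow> 'v \<Rightarrow> 't) \<Rightarrow>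
   'w measure \<Rightarrow> 's measure \<Rightarrow> (int \<Rightarrow> 'w \<Rightarrow> 's) \<Rightarrow> ((int \<Rightarrow> 't) \<Rightarrow> (int \<Rightarrow> 's)) \<Rightarrow> bool" where
  "is_coding \<Gamma> N T Y M A X \<phi> \<longleftrightarrow>
     \<phi> \<in> measurable (configs T) (configs A) \<and>
     (\<forall>\<gamma>\<in>\<Gamma>. \<forall>y\<in>space (configs T). \<phi> (\<lambda>i. y (\<gamma> i)) = (\<lambda>i. \<phi> y (\<gamma> i))) \<and>
     distr N (configs A) (\<lambda>\<omega>. \<phi> (\<lambda>i. Y i \<omega>)) = field_law M A X"

text \<open>In both definitions of the coding radius the infimum is a minimum when the set is nonempty,
  and \<open>\<infinity>\<close> otherwise.\<close>

definition coding_radius ::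
  "'t set \<Rightarrow> ((int \<Rightarrow> 't) \<Rightarrow> (int \<Rightarrow> 's)) \<Rightarrow> (int \<Rightarrow> 't) \<Rightarrow> enat" where
  "coding_radius T \<phi> y =
     Inf {enat r |r. \<forall>y'\<in>UNIV \<rightarrow> T. (\<forall>v. \<bar>v\<bar> \<le> int r \<longrightarrow> y' v = y v) \<longrightarrow> \<phi> y' 0 = \<phi> y 0}"

text \<open>The factors of the product alphabet are indexed from \<open>0\<close>, so that the first \<open>n\<close> coordinates
  are those with index \<open>k < n\<close>.\<close>

definition product_coding_radius ::
  "(nat \<Rightarrow> 't set) \<Rightarrow> ((int \<Rightarrow> nat \<Rightarrow> 't) \<Rightarrow> (int \<Rightarrow> 's)) \<Rightarrow> (int \<Rightarrow> nat \<Rightarrow> 't) \<Rightarrow> enat" where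
  "product_coding_radius T \<phi> y =
     Inf {enat r |r. \<exists>n. \<forall>y'\<in>UNIV \<rightarrow> Pi UNIV T.
            (\<forall>v. \<bar>v\<bar> \<le> int r \<longrightarrow> (\<forall>k<n. y' v k = y v k)) \<longrightarrow> \<phi> y' 0 = \<phi> y 0}"

text \<open>A coding whose radius (given as a function \<open>R\<close> of the configuration) is almost surely finite
  and satisfies \<open>P(R > r) \<le> b r\<close> for all \<open>r \<ge> 1\<close>.  For the radii above, \<open>{y. R y \<le> r}\<close> is a
  countable union of cylinder sets, so the event whose probability is taken is measurable.\<close>

definition finitary_coding_with_tail ::
  "(int \<Rightarrow> int) set \<Rightarrow> 'v measure \<Rightarrow> 't measure \<Rightarrow> (int \<Rightarrow> 'v \<Rightarrow> 't) \<Rightarrow>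
   'w measure \<Rightarrow> 's measure \<Rightarrow> (int \<Rightarrow> 'w \<Rightarrow> 's) \<Rightarrow> ((int \<Rightarrow> 't) \<Rightarrow> (int \<Rightarrow> 's)) \<Rightarrow>
   ((int \<Rightarrow> 't) \<Rightarrow> enat) \<Rightarrow> (nat \<Rightarrow> real) \<Rightarrow> bool" where
  "finitary_coding_with_tail \<Gamma> N T Y M A X \<phi> R b \<longleftrightarrow>
     is_coding \<Gamma> N T Y M A X \<phi> \<and>
     (AE \<omega> in N. R (\<lambda>i. Y i \<omega>) < \<infinity>) \<and>
     (\<forall>r\<ge>1. measure N {\<omega> \<in> space N. R (\<lambda>i. Y i \<omega>) > enat r} \<le> b r)"

text \<open>The alphabet of the i.i.d. process is either finite or countable, or an infinite product of
  finite sets.  Up to relabelling, the countable alphabet and the finite factors are sets of natural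
  numbers, and the process lives on its canonical sample space; this fixes the types of the
  existentially quantified objects.\<close>

definition finitary_iid_factor_with_tail ::
  "(int \<Rightarrow> int) set \<Rightarrow> 'w measure \<Rightarrow> 's measure \<Rightarrow> (int \<Rightarrow> 'w \<Rightarrow> 's) \<Rightarrow> (nat \<Rightarrow> real) \<Rightarrow> bool" where
  "finitary_iid_factor_with_tail \<Gamma> M A X b \<longleftrightarrow>
     (\<exists>(T :: nat set) (N :: (int \<Rightarrow> nat) measure) Y \<phi>.
        iid_process N (count_space T) Y \<and>
        finitary_coding_with_tail \<Gamma> N (count_space T) Y M A X \<phi> (coding_radius T \<phi>) b) \<or>
     (\<exists>(T :: nat \<Rightarrow> nat set) (N :: (int \<Rightarrow> nat \<Rightarrow> nat) measure) Y \<phi>.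
        (\<forall>k. finite (T k)) \<and>
        iid_process N (Pi\<^sub>M UNIV (\<lambda>k. count_space (T k))) Y \<and>
        finitary_coding_with_tail \<Gamma> N (Pi\<^sub>M UNIV (\<lambda>k. count_space (T k))) Y M A X \<phi>
          (product_coding_radius T \<phi>) b)"

end

theory Submission
  imports Defs "HOL-Library.Fun_Lexorder"
begin

text \<open>Give the sites i.i.d. random labels and sample the field site by site in the order of the labels.
  When \<open>v\<close> is reached, the sampled sites that matter for \<open>X\<^sub>v\<close> are, by 1-dependence, those in its cluster:
  the maximal interval around \<open>v\<close> in which all labels other than that of \<open>v\<close> are smaller.  So \<open>X\<^sub>v\<close> is drawn from the
  conditional law given the values on the cluster, which are themselves determined by sub-clusters.
  Only countably many conditional laws occur, and each site carries one independent sample from each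
  of them; selecting a sample by its law, not by the geometry, makes the construction
  \<open>\<Gamma>\<close>-equivariant.  The radius at \<open>0\<close> exceeds \<open>r\<close> only if \<open>0\<close> has the largest label
  in \<open>[0, r]\<close> or in \<open>[-r, 0]\<close>, and by exchangeability this has probability at most \<open>2 / (r + 1)\<close>.\<close>

section \<open>Sequential sampling along a random order\<close>

text \<open>Which sample a site reads depends on values drawn earlier, so the field looks circular.
  It is untangled on a finite window: once the order of the labels there is fixed, "the field equals
  \<open>x\<close>" says that every site's own sample, taken from the law computed from
  \<open>x\<close>, equals the prescribed value. These events are independent, and the product of
  their probabilities telescopes to the law of \<open>X\<close> at \<open>x\<close>, whatever the
  order. The window then grows to all of the integers, the error being the probability that a
  cluster leaves it. Equivariance is demanded at every configuration, not just almost surely. Hence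
  nothing is discarded and ties are not broken: the order may be partial, sampling is total with
  default value 0, and absence of ties is invoked only for probabilities and for the radius. The
  allowed alphabets are the last obstacle: samples are unbounded natural numbers, infinitely many
  per site. Each is therefore written as a row of bits with a single 1, which can be read off after
  finitely many bits.\<close>

definition cluster :: "(int \<times> int) set \<Rightarrow> int \<Rightarrow> int set" where
  "cluster r v = {u. \<forall>w\<in>{min u v..max u v}. w \<noteq> v \<longrightarrow> (w, v) \<in> r}"

text \<open>The recursion runs along a relation that need not be well-founded, so it is cut off
  after a number of rounds. \<open>w v\<close> is a table of prepared samples and \<open>g\<close>
  chooses the entry to read; the default 0 on infinite clusters keeps the function total.\<close>

primrec stage ::
  "(int \<Rightarrow> int set \<Rightarrow> (int \<Rightarrow> nat) \<Rightarrow> nat) \<Rightarrow> (int \<times> int) set \<Rightarrow> (int \<Rightarrow> nat \<Rightarrow> nat) \<Rightarrow> nat \<Rightarrow> int \<Rightarrow> nat" where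
  "stage g r w 0 = (\<lambda>v. 0)"
| "stage g r w (Suc n) = (\<lambda>v. if finite (cluster r v)
     then w v (g v (cluster r v - {v}) (stage g r w n)) else 0)"

text \<open>As many rounds as the cluster has sites are enough, because clusters shrink strictly
  along the recursion. An infinite cluster has \<open>card\<close> 0 and so yields the default
  0.\<close>

definition sampled ::
  "(int \<Rightarrow> int set \<Rightarrow> (int \<Rightarrow> nat) \<Rightarrow> nat) \<Rightarrow> (int \<times> int) set \<Rightarrow> (int \<Rightarrow> nat \<Rightarrow> nat) \<Rightarrow> int \<Rightarrow> nat" where
  "sampled g r w v = stage g r w (card (cluster r v)) v"

lemma self_in_cluster [simp]: "v \<in> cluster r v"
  by (auto simp: cluster_def)

lemma cluster_rel: "u \<in> cluster r v \<Longrightarrow> u \<noteq> v \<Longrightarrow> (u, v) \<in> r"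
  by (auto simp: cluster_def)

text \<open>A site between \<open>z\<close> and \<open>v\<close> either lies between
  \<open>u\<close> and \<open>v\<close>, or is \<open>r\<close>-below \<open>u\<close> and hence
  below \<open>v\<close> by transitivity. Strictness comes from \<open>v\<close> itself, which is
  not below \<open>u\<close>. This is the termination argument of the whole construction.\<close>

lemma cluster_psubset:
  assumes "trans r" "irrefl r" "u \<in> cluster r v" "u \<noteq> v"
  shows "cluster r u \<subset> cluster r v"
proof
  have uv: "(u, v) \<in> r" using assms cluster_rel by blast
  have nvu: "(v, u) \<notin> r" using assms(1,2) uv by (meson irreflD transD)
  show "cluster r u \<subseteq> cluster r v"
  proof
    fix z assume z: "z \<in> cluster r u"
    show "z \<in> cluster r v"
      unfolding cluster_def
    proof clarify
      fix w assume w: "w \<in> {min z v..max z v}" "w \<noteq> v"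
      show "(w, v) \<in> r"
      proof (cases "w \<in> {min u v..max u v}")
        case True
        then show ?thesis using assms(3) w by (auto simp: cluster_def)
      next
        case False
        then have "w \<in> {min z u..max z u}" "w \<noteq> u" using w by auto
        then have "(w, u) \<in> r" using z by (auto simp: cluster_def)
        then show ?thesis using uv assms(1) by (meson transD)
      qed
    qed
  qed
  show "cluster r u \<noteq> cluster r v"
    using nvu assms(4) cluster_rel[of v r u] self_in_cluster[of v r] by blast
qed

lemma cluster_subset:
  assumes "trans r" "irrefl r" "u \<in> cluster r v"
  shows "cluster r u \<subseteq> cluster r v"
  using cluster_psubset[OF assms] by (cases "u = v") auto

lemma card_cluster_less:
  assumes "trans r" "irrefl r" "u \<in> cluster r v - {v}" "finite (cluster r v)"
  shows "card (cluster r u) < card (cluster r v)" "finite (cluster r u)"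
proof -
  have "cluster r u \<subset> cluster r v" using cluster_psubset[OF assms(1,2)] assms(3) by blast
  then show "card (cluster r u) < card (cluster r v)" "finite (cluster r u)"
    using assms(4) by (auto intro: psubset_card_mono finite_subset)
qed

locale sampling_rule =
  fixes g :: "int \<Rightarrow> int set \<Rightarrow> (int \<Rightarrow> nat) \<Rightarrow> nat"
  assumes rule_cong: "\<And>v K x y. (\<And>u. u \<in> K \<Longrightarrow> x u = y u) \<Longrightarrow> g v K x = g v K y"
begin

text \<open>Surplus rounds change nothing: the sites consulted have smaller clusters, so by
  induction they are already stable one round earlier.\<close>

lemma stage_eq_sampled:
  assumes "trans r" "irrefl r" "finite (cluster r v)" "card (cluster r v) \<le> n"
  shows "stage g r w n v = sampled g r w v"
  using assms(3,4)
proof (induction n arbitrary: v rule: less_induct)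
  case (less n)
  have "card (cluster r v) \<noteq> 0"
    using less.prems(1) self_in_cluster by (metis card_0_eq empty_iff)
  then obtain m where m: "card (cluster r v) = Suc m" by (cases "card (cluster r v)") auto
  then obtain n' where n': "n = Suc n'" using less.prems by (cases n) auto
  have "stage g r w n' u = stage g r w m u" if "u \<in> cluster r v - {v}" for u
  proof -
    have "card (cluster r u) < card (cluster r v)" "finite (cluster r u)"
      using card_cluster_less[OF assms(1,2) that less.prems(1)] by auto
    then show ?thesis using less.IH[of n' u] less.IH[of m u] m n' less.prems by auto
  qed
  then have "g v (cluster r v - {v}) (stage g r w n') = g v (cluster r v - {v}) (stage g r w m)"
    by (intro rule_cong) auto
  then show ?case using less.prems by (simp add: sampled_def m n')
qed

lemma sampled_unfold:
  assumes "trans r" "irrefl r" "finite (cluster r v)"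
  shows "sampled g r w v = w v (g v (cluster r v - {v}) (sampled g r w))"
proof -
  have "sampled g r w v = stage g r w (Suc (card (cluster r v))) v"
    using assms by (intro stage_eq_sampled[symmetric]) auto
  also have "\<dots> = w v (g v (cluster r v - {v}) (stage g r w (card (cluster r v))))"
    using assms by simp
  also have "g v (cluster r v - {v}) (stage g r w (card (cluster r v)))
      = g v (cluster r v - {v}) (sampled g r w)"
    using card_cluster_less[OF assms(1,2) _ assms(3)]
    by (intro rule_cong stage_eq_sampled assms) (auto intro: less_imp_le)
  finally show ?thesis .
qed

text \<open>At each site of the cluster only one table entry is ever read, so agreement of that
  entry suffices. The lemma serves twice: to compare a finite window with all sites, and to compare
  two noise configurations when bounding the radius.\<close>

lemma sampled_local:
  assumes "trans r" "irrefl r" "trans r'" "irrefl r'" "finite (cluster r v)"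
    and "\<And>u. u \<in> cluster r v \<Longrightarrow> cluster r' u = cluster r u"
    and "\<And>u. u \<in> cluster r v \<Longrightarrow> w' u (g u (cluster r u - {u}) (sampled g r w))
            = w u (g u (cluster r u - {u}) (sampled g r w))"
  shows "sampled g r' w' v = sampled g r w v"
  using assms(5-)
proof (induction "card (cluster r v)" arbitrary: v rule: less_induct)
  case less
  have eq: "cluster r' v = cluster r v" using less.prems(2) by auto
  have "sampled g r' w' u = sampled g r w u" if u: "u \<in> cluster r v - {v}" for u
  proof -
    have sub: "cluster r u \<subseteq> cluster r v" using cluster_subset assms(1,2) u by blast
    show ?thesis
      using card_cluster_less[OF assms(1,2) u less.prems(1)] less.prems(2,3) sub
      by (intro less.hyps) auto
  qed
  then have "g v (cluster r v - {v}) (sampled g r' w') = g v (cluster r v - {v}) (sampled g r w)"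
    by (intro rule_cong) auto
  then show ?case
    using less.prems(1) less.prems(3)[of v] eq
    by (simp add: sampled_unfold[OF assms(1,2)] sampled_unfold[OF assms(3,4)])
qed

text \<open>Removes the circularity: on the right the entry read at \<open>u\<close> is computed
  from the target \<open>x\<close>, not from the random field. For fixed \<open>r\<close> the event
  thus constrains one predetermined sample per site. The converse direction is an induction on
  cluster size.\<close>

lemma sampled_eq_iff:
  assumes "trans r" "irrefl r" "finite I" "r \<subseteq> I \<times> I"
  shows "(\<forall>u\<in>I. sampled g r w u = x u) \<longleftrightarrow> (\<forall>u\<in>I. w u (g u (cluster r u - {u}) x) = x u)"
proof -
  have sub: "cluster r u \<subseteq> I" if "u \<in> I" for u
    using assms(4) that cluster_rel by blast
  then have fin: "finite (cluster r u)" if "u \<in> I" for u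
    using that assms(3) finite_subset by blast
  note unf = sampled_unfold[OF assms(1,2) fin]
  show ?thesis
  proof safe
    fix u assume *: "\<forall>u\<in>I. sampled g r w u = x u" and u: "u \<in> I"
    have "g u (cluster r u - {u}) (sampled g r w) = g u (cluster r u - {u}) x"
      using * sub[OF u] by (intro rule_cong) auto
    then show "w u (g u (cluster r u - {u}) x) = x u" using * u unf[OF u, of w] by simp
  next
    fix u assume *: "\<forall>u\<in>I. w u (g u (cluster r u - {u}) x) = x u" and u: "u \<in> I"
    from u show "sampled g r w u = x u"
    proof (induction "card (cluster r u)" arbitrary: u rule: less_induct)
      case less
      have "g u (cluster r u - {u}) (sampled g r w) = g u (cluster r u - {u}) x"
        using sub[OF less.prems] card_cluster_less(1)[OF assms(1,2) _ fin[OF less.prems]]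
        by (intro rule_cong less.hyps) auto
      then show ?case using unf[OF less.prems, of w] * less.prems by simp
    qed
  qed
qed

end

section \<open>Equivariance\<close>

text \<open>All increments are 1 or -1, and a sign change would give
  \<open>\<gamma> (i + 2) = \<gamma> i\<close>. So only translations and reflections occur.\<close>

lemma graph_automorphism_affine:
  assumes "graph_automorphism \<gamma>"
  obtains c s where "s = 1 \<or> s = -1" "\<And>i. \<gamma> i = c + s * i"
proof -
  have adj: "\<bar>\<gamma> (i + 1) - \<gamma> i\<bar> = 1" for i
    using assms unfolding graph_automorphism_def int_adj_def
    by (metis add_diff_cancel_left' abs_one)
  have inj: "\<gamma> i = \<gamma> j \<longleftrightarrow> i = j" for i j
    using assms unfolding graph_automorphism_def by (simp add: bij_is_inj inj_eq)
  define d where "d i = \<gamma> (i + 1) - \<gamma> i" for i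
  have step: "d (i + 1) = d i" for i
  proof -
    have "d (i + 1) + d i \<noteq> 0"
      using inj[of "i + 2" i] by (simp add: d_def add.assoc)
    moreover have "\<bar>d i\<bar> = 1" "\<bar>d (i + 1)\<bar> = 1"
      using adj[of i] adj[of "i + 1"] by (simp_all add: d_def)
    ultimately show ?thesis by linarith
  qed
  have step': "d (i - 1) = d i" for i
    using step[of "i - 1"] by simp
  have d: "d i = d 0" for i
    by (induction i rule: int_induct[where k=0]) (auto simp: step step')
  have "\<gamma> i = \<gamma> 0 + d 0 * i" for i
  proof (induction i rule: int_induct[where k=0])
    case (step1 i)
    then show ?case using d[of i] by (simp add: d_def algebra_simps)
  next
    case (step2 i)
    then show ?case using d[of "i - 1"] by (simp add: d_def algebra_simps)
  qed simp
  moreover have "d 0 = 1 \<or> d 0 = -1" using adj[of 0] by (auto simp: d_def)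
  ultimately show ?thesis using that by blast
qed

text \<open>A cluster is defined through segments without distinguishing left from right, and
  translations and reflections both carry segments to segments.\<close>

lemma cluster_image:
  assumes "graph_automorphism \<gamma>" and r: "\<And>u w. (u, w) \<in> r' \<longleftrightarrow> (\<gamma> u, \<gamma> w) \<in> r"
  shows "cluster r (\<gamma> v) = \<gamma> ` cluster r' v"
proof -
  obtain c s where s: "s = 1 \<or> s = -1" and \<gamma>: "\<And>i. \<gamma> i = c + s * i"
    by (rule graph_automorphism_affine[OF assms(1)]) (rule that)
  have seg: "{min (\<gamma> u) (\<gamma> v)..max (\<gamma> u) (\<gamma> v)} = \<gamma> ` {min u v..max u v}" for u v
    using s
  proof
    assume "s = 1"
    then have "\<gamma> = (+) c" by (auto simp: \<gamma>)
    then show ?thesis by (simp add: min_def max_def)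
  next
    assume "s = -1"
    then have "\<gamma> = (-) c" by (auto simp: \<gamma>)
    then show ?thesis by (simp add: max_diff_distrib_left min_def max_def)
  qed
  have inj: "\<gamma> i = \<gamma> j \<longleftrightarrow> i = j" for i j
    using assms(1) unfolding graph_automorphism_def by (simp add: bij_is_inj inj_eq)
  have mem: "\<gamma> u \<in> cluster r (\<gamma> v) \<longleftrightarrow> u \<in> cluster r' v" for u
    by (simp only: cluster_def mem_Collect_eq seg Set.ball_simps(9) inj r)
  have "surj \<gamma>" using assms(1) unfolding graph_automorphism_def by (auto dest: bij_is_surj)
  then have "\<gamma> ` (\<gamma> -` cluster r (\<gamma> v)) = cluster r (\<gamma> v)" by (rule surj_image_vimage_eq)
  moreover have "\<gamma> -` cluster r (\<gamma> v) = cluster r' v" using mem by (simp add: vimage_def)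
  ultimately show ?thesis by simp
qed

text \<open>Holds for every \<open>r\<close> and \<open>w\<close>, with infinite clusters included:
  those are preserved by \<open>\<gamma>\<close> and receive 0 on both sides.\<close>

lemma sampled_equivariant:
  assumes "graph_automorphism \<gamma>" and r: "\<And>u w. (u, w) \<in> r' \<longleftrightarrow> (\<gamma> u, \<gamma> w) \<in> r"
    and g: "\<And>v K x. finite K \<Longrightarrow> g v K (\<lambda>i. x (\<gamma> i)) = g (\<gamma> v) (\<gamma> ` K) x"
  shows "sampled g r' (\<lambda>i. w (\<gamma> i)) v = sampled g r w (\<gamma> v)"
proof -
  have inj: "inj \<gamma>"
    using assms(1) unfolding graph_automorphism_def by (auto dest: bij_is_inj)
  note cl = cluster_image[OF assms(1,2)]
  have fin: "finite (cluster r (\<gamma> v)) \<longleftrightarrow> finite (cluster r' v)" for v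
    using inj by (simp add: cl finite_image_iff inj_on_subset)
  have "stage g r' (\<lambda>i. w (\<gamma> i)) n = (\<lambda>v. stage g r w n (\<gamma> v))" for n
  proof (induction n)
    case (Suc n)
    show ?case
    proof
      fix v
      have im: "\<gamma> ` (cluster r' v - {v}) = cluster r (\<gamma> v) - {\<gamma> v}"
        using inj by (simp add: cl image_set_diff)
      show "stage g r' (\<lambda>i. w (\<gamma> i)) (Suc n) v = stage g r w (Suc n) (\<gamma> v)"
      proof (cases "finite (cluster r' v)")
        case True
        then show ?thesis
          using g[of "cluster r' v - {v}" v "stage g r w n"] by (simp add: fin Suc im)
      next
        case False
        then show ?thesis by (simp add: fin)
      qed
    qed
  qed simp
  moreover have "card (cluster r (\<gamma> v)) = card (cluster r' v)"
    using inj by (simp add: cl card_image inj_on_subset)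
  ultimately show ?thesis by (simp add: sampled_def)
qed

section \<open>Conditional laws of a 1-dependent field\<close>

definition cyl :: "int set \<Rightarrow> (int \<Rightarrow> nat) \<Rightarrow> (int \<Rightarrow> nat) set" where
  "cyl K x = {z. \<forall>i\<in>K. z i = x i}"

lemma cyl_cong: "(\<And>i. i \<in> K \<Longrightarrow> x i = y i) \<Longrightarrow> cyl K x = cyl K y"
  by (auto simp: cyl_def)

lemma cyl_Un: "cyl (A \<union> B) x = cyl A x \<inter> cyl B x"
  by (auto simp: cyl_def)

locale one_dependent_law = prob_space P for P :: "(int \<Rightarrow> nat) measure" +
  assumes sets_P [measurable_cong]: "sets P = sets (Pi\<^sub>M UNIV (\<lambda>_. count_space UNIV))"
    and cyl_indep: "\<And>A B x. finite A \<Longrightarrow> finite B \<Longrightarrow> (\<forall>i\<in>A. \<forall>j\<in>B. \<bar>i - j\<bar> > 1) \<Longrightarrow>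
      measure P (cyl (A \<union> B) x) = measure P (cyl A x) * measure P (cyl B x)"
begin

lemma space_P: "space P = UNIV"
  using sets_eq_imp_space_eq[OF sets_P] by (simp add: space_PiM)

lemma coordinate_measurable [measurable]: "(\<lambda>z. z v) \<in> measurable P (count_space UNIV)"
proof -
  have "(\<lambda>z. z v) \<in> measurable (Pi\<^sub>M UNIV (\<lambda>_. count_space UNIV)) (count_space UNIV)"
    by measurable
  then show ?thesis using measurable_cong_sets[OF sets_P refl] by blast
qed

lemma cyl_sets [measurable]: "finite K \<Longrightarrow> cyl K x \<in> sets P"
proof -
  assume [simp]: "finite K"
  have "Measurable.pred P (\<lambda>z. \<forall>i\<in>K. z i = x i)" by measurable
  then show ?thesis by (simp add: cyl_def space_P pred_def)
qed

text \<open>The default on null cylinders makes this a probability measure for every finite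
  \<open>K\<close> and every \<open>x\<close>, so a sample can be prepared even for histories that
  \<open>P\<close> excludes.\<close>

definition cond_law :: "int \<Rightarrow> int set \<Rightarrow> (int \<Rightarrow> nat) \<Rightarrow> nat measure" where
  "cond_law v K x = (if measure P (cyl K x) = 0 then return (count_space UNIV) 0
     else distr (uniform_measure P (cyl K x)) (count_space UNIV) (\<lambda>z. z v))"

lemma cond_law_cong: "(\<And>i. i \<in> K \<Longrightarrow> x i = y i) \<Longrightarrow> cond_law v K x = cond_law v K y"
  using cyl_cong[of K x y] by (simp add: cond_law_def)

lemma sets_cond_law: "sets (cond_law v K x) = UNIV"
  by (simp add: cond_law_def)

lemma prob_space_cond_law:
  assumes "finite K"
  shows "prob_space (cond_law v K x)"
proof (cases "measure P (cyl K x) = 0")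
  case True
  then show ?thesis by (simp add: cond_law_def prob_space_return)
next
  case False
  then have "emeasure P (cyl K x) \<noteq> 0" by (simp add: emeasure_eq_measure)
  then interpret U: prob_space "uniform_measure P (cyl K x)"
    by (intro prob_space_uniform_measure) simp_all
  show ?thesis using False by (simp add: cond_law_def U.prob_space_distr)
qed

lemma cond_law_singleton:
  assumes "finite K" "measure P (cyl K x) \<noteq> 0"
  shows "measure (cond_law v K x) {n} = measure P (cyl K x \<inter> cyl {v} (\<lambda>_. n)) / measure P (cyl K x)"
proof -
  have "{z \<in> space P. z v = n} = cyl {v} (\<lambda>_. n)" by (auto simp: cyl_def space_P)
  then have "(\<lambda>z. z v) -` {n} \<inter> space P = cyl {v} (\<lambda>_. n)" by auto
  then show ?thesis
    using assms by (simp add: cond_law_def measure_distr emeasure_eq_measure)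
qed

text \<open>On a null cylinder both sides vanish, whatever the default law is.\<close>

lemma cond_law_mult:
  assumes "finite K"
  shows "measure P (cyl K x) * measure (cond_law v K x) {x v} = measure P (cyl (insert v K) x)"
proof -
  have eq: "cyl K x \<inter> cyl {v} (\<lambda>_. x v) = cyl (insert v K) x" by (auto simp: cyl_def)
  show ?thesis
  proof (cases "measure P (cyl K x) = 0")
    case True
    have "measure P (cyl (insert v K) x) \<le> measure P (cyl K x)"
      using assms by (intro finite_measure_mono cyl_sets) (auto simp: cyl_def)
    then show ?thesis using True measure_nonneg[of P "cyl (insert v K) x"] by simp
  next
    case False
    then show ?thesis using cond_law_singleton[OF assms False] eq by simp
  qed
qed

text \<open>Only the values of \<open>x\<close> on the finite set \<open>K\<close> matter, which
  leaves countably many triples.\<close>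

lemma countable_cond_laws: "countable {cond_law v K x |v K x. finite K}"
proof -
  have "{cond_law v K x |v K x. finite K}
      \<subseteq> (\<Union>v. \<Union>K\<in>{K. finite K}. cond_law v K ` (PiE K (\<lambda>_. UNIV)))" (is "_ \<subseteq> ?R")
  proof clarify
    fix v and K :: "int set" and x :: "int \<Rightarrow> nat" assume "finite K"
    moreover have "cond_law v K x = cond_law v K (restrict x K)"
      by (intro cond_law_cong) simp
    moreover have "restrict x K \<in> PiE K (\<lambda>_. UNIV)" by simp
    ultimately show "cond_law v K x \<in> ?R" by blast
  qed
  moreover have "countable ?R"
    by (intro countable_UN countable_image countable_PiE countable_Collect_finite) auto
  ultimately show ?thesis by (rule countable_subset)
qed

text \<open>Equality as measures is what is wanted: the samples are indexed by the laws themselves,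
  so \<open>v\<close> in the shifted configuration and \<open>\<gamma> v\<close> in the original
  read the same entry.\<close>

lemma cond_law_invariant:
  assumes "finite K" and inj: "inj \<gamma>"
    and inv: "\<And>K x. finite K \<Longrightarrow> measure P (cyl K (\<lambda>i. x (\<gamma> i))) = measure P (cyl (\<gamma> ` K) x)"
  shows "cond_law v K (\<lambda>i. x (\<gamma> i)) = cond_law (\<gamma> v) (\<gamma> ` K) x"
proof (rule measure_eqI_countable[where A = UNIV])
  fix n
  have fin: "finite (\<gamma> ` K)" using assms by simp
  interpret A: prob_space "cond_law v K (\<lambda>i. x (\<gamma> i))" by (rule prob_space_cond_law[OF assms(1)])
  interpret B: prob_space "cond_law (\<gamma> v) (\<gamma> ` K) x" by (rule prob_space_cond_law[OF fin])
  show "emeasure (cond_law v K (\<lambda>i. x (\<gamma> i))) {n} = emeasure (cond_law (\<gamma> v) (\<gamma> ` K) x) {n}"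
  proof (cases "measure P (cyl (\<gamma> ` K) x) = 0")
    case True
    then show ?thesis using inv[OF assms(1), of x] by (simp add: cond_law_def)
  next
    case False
    have "measure P (cyl K (\<lambda>i. x (\<gamma> i)) \<inter> cyl {v} (\<lambda>_. n))
        = measure P (cyl (\<gamma> ` K) x \<inter> cyl {\<gamma> v} (\<lambda>_. n))"
    proof (cases "v \<in> K \<and> x (\<gamma> v) \<noteq> n")
      case True
      then have "cyl K (\<lambda>i. x (\<gamma> i)) \<inter> cyl {v} (\<lambda>_. n) = {}"
          "cyl (\<gamma> ` K) x \<inter> cyl {\<gamma> v} (\<lambda>_. n) = {}" by (auto simp: cyl_def)
      then show ?thesis by simp
    next
      case False
      let ?y = "x(\<gamma> v := n)"
      have y: "?y j = x j" if "j \<in> \<gamma> ` K" for j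
        using False inj that by (auto simp: inj_eq)
      have "cyl (insert v K) (\<lambda>i. ?y (\<gamma> i)) = cyl K (\<lambda>i. ?y (\<gamma> i)) \<inter> cyl {v} (\<lambda>i. ?y (\<gamma> i))"
        using cyl_Un[of K "{v}"] by simp
      also have "\<dots> = cyl K (\<lambda>i. x (\<gamma> i)) \<inter> cyl {v} (\<lambda>_. n)"
        by (intro arg_cong2[where f = "(\<inter>)"] cyl_cong y) auto
      finally have 1: "cyl K (\<lambda>i. x (\<gamma> i)) \<inter> cyl {v} (\<lambda>_. n) = cyl (insert v K) (\<lambda>i. ?y (\<gamma> i))" ..
      have "cyl (\<gamma> ` insert v K) ?y = cyl (\<gamma> ` K) ?y \<inter> cyl {\<gamma> v} ?y"
        using cyl_Un[of "\<gamma> ` K" "{\<gamma> v}"] by simp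
      also have "\<dots> = cyl (\<gamma> ` K) x \<inter> cyl {\<gamma> v} (\<lambda>_. n)"
        by (intro arg_cong2[where f = "(\<inter>)"] cyl_cong y) auto
      finally have 2: "cyl (\<gamma> ` K) x \<inter> cyl {\<gamma> v} (\<lambda>_. n) = cyl (\<gamma> ` insert v K) ?y" ..
      show ?thesis unfolding 1 2 using inv[of "insert v K" ?y] assms(1) by simp
    qed
    then show ?thesis
      using cond_law_singleton[OF fin False] cond_law_singleton[OF assms(1), of "\<lambda>i. x (\<gamma> i)"]
        False inv[OF assms(1), of x] unfolding A.emeasure_eq_measure B.emeasure_eq_measure by presburger
  qed
qed (simp_all add: sets_cond_law)

text \<open>The last site of \<open>D\<close> in the order \<open>r\<close> depends on the other sites of \<open>D\<close> only through its cluster,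
  because every other site of \<open>D\<close> is at distance more than 1 from that cluster.\<close>

lemma chain_rule:
  assumes "trans r" "irrefl r" "finite D" and tot: "\<And>u v. u \<in> D \<Longrightarrow> v \<in> D \<Longrightarrow> u \<noteq> v \<Longrightarrow> (u, v) \<in> r \<or> (v, u) \<in> r"
    and down: "\<And>u v. v \<in> D \<Longrightarrow> (u, v) \<in> r \<Longrightarrow> u \<in> D"
  shows "(\<Prod>u\<in>D. measure (cond_law u (cluster r u - {u}) x) {x u}) = measure P (cyl D x)"
  using assms(3-)
proof (induction "card D" arbitrary: D)
  case 0
  then have "cyl D x = space P" by (auto simp: cyl_def space_P)
  then show ?case using 0 by (simp add: prob_space)
next
  case (Suc n)
  have D: "finite D" "D \<noteq> {}" using Suc by auto
  have "\<exists>m\<in>D. \<forall>u\<in>D. (m, u) \<notin> r"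
  proof -
    \<comment> \<open>A finite acyclic relation has a well-founded converse; a minimal element for
      the converse is the site of \<open>D\<close> sampled last.\<close>
    have "wf ((Restr r D)\<inverse>)"
    proof (rule finite_acyclic_wf_converse)
      show "finite (Restr r D)" using D by (auto intro: finite_subset[of _ "D \<times> D"])
      have "acyclic r" using assms(2) unfolding acyclic_def trancl_id[OF assms(1)] by (auto dest: irreflD)
      then show "acyclic (Restr r D)" by (rule acyclic_subset) blast
    qed
    moreover obtain d where "d \<in> D" using D(2) by blast
    ultimately have "\<exists>m\<in>D. \<forall>u. (u, m) \<in> (Restr r D)\<inverse> \<longrightarrow> u \<notin> D"
      by (rule wf_eq_minimal[THEN iffD1, rule_format])
    then show ?thesis by blast
  qed
  then obtain m where m: "m \<in> D" "\<And>u. u \<in> D \<Longrightarrow> (m, u) \<notin> r" by blast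
  have below: "(u, m) \<in> r" if "u \<in> D" "u \<noteq> m" for u
    using Suc.prems(2)[OF that(1) m(1)] m(2)[OF that(1)] that(2) by blast
  define C where "C = cluster r m - {m}"
  define B where "B = D - {m} - C"
  have C: "C \<subseteq> D - {m}"
    using cluster_rel Suc.prems(3)[OF m(1)] by (auto simp: C_def)
  have fin: "finite C" "finite B" "finite (insert m C)" using D C finite_subset by (auto simp: B_def)
  have far: "\<bar>i - j\<bar> > 1" if i: "i \<in> insert m C" and j: "j \<in> B" for i j
  proof (rule ccontr)
    assume "\<not> \<bar>i - j\<bar> > 1"
    \<comment> \<open>If \<open>j\<close> were within distance 1 of \<open>i\<close>, the segment
      from \<open>j\<close> to \<open>m\<close> would add only \<open>j\<close> to the one from
      \<open>i\<close> to \<open>m\<close>. Since \<open>j\<close> is below \<open>m\<close>, it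
      would then belong to the cluster.\<close>
    then have near: "{min j m..max j m} \<subseteq> insert j {min i m..max i m}" by auto
    have "i \<in> cluster r m" using i by (auto simp: C_def)
    moreover have "(j, m) \<in> r" using j below by (auto simp: B_def)
    ultimately have "j \<in> cluster r m" using near by (auto simp: cluster_def)
    then show False using j by (auto simp: B_def C_def)
  qed
  have "(\<Prod>u\<in>D - {m}. measure (cond_law u (cluster r u - {u}) x) {x u}) = measure P (cyl (D - {m}) x)"
  proof (rule Suc.hyps(1))
    show "n = card (D - {m})" using Suc.hyps(2) m(1) D by simp
    show "u \<in> D - {m}" if "v \<in> D - {m}" "(u, v) \<in> r" for u v
      using that Suc.prems(3) m(2) by blast
  qed (use D Suc.prems(2) in auto)
  then have "(\<Prod>u\<in>D. measure (cond_law u (cluster r u - {u}) x) {x u})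
      = measure (cond_law m C x) {x m} * measure P (cyl (C \<union> B) x)"
    using D m(1) C by (simp add: prod.remove[of D m] C_def B_def Un_absorb1)
  \<comment> \<open>1-dependence is applied twice: here to split \<open>B\<close> off from
    \<open>C\<close>, and below to join \<open>B\<close> again after the factor for \<open>m\<close>
    has extended \<open>C\<close> to \<open>insert m C\<close>.\<close>
  also have "measure P (cyl (C \<union> B) x) = measure P (cyl C x) * measure P (cyl B x)"
    using fin far by (intro cyl_indep) auto
  also have "measure (cond_law m C x) {x m} * (measure P (cyl C x) * measure P (cyl B x))
      = measure P (cyl (insert m C) x) * measure P (cyl B x)"
    using cond_law_mult[OF fin(1), of x m] by (simp add: mult_ac)
  also have "\<dots> = measure P (cyl (insert m C \<union> B) x)"
    using fin far by (intro cyl_indep[symmetric]) auto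
  also have "insert m C \<union> B = D" using C m(1) by (auto simp: B_def)
  finally show ?case .
qed

end

section \<open>Lexicographic label order and measurability\<close>

lemma finite_int_iff_bounded: "finite S \<longleftrightarrow> (\<exists>k::int. \<forall>x\<in>S. \<bar>x\<bar> \<le> k)"
proof
  assume "finite S"
  then have "bdd_above (abs ` S)" by (intro bdd_above_finite finite_imageI)
  then show "\<exists>k. \<forall>x\<in>S. \<bar>x\<bar> \<le> k" by (auto simp: bdd_above_def)
next
  assume "\<exists>k. \<forall>x\<in>S. \<bar>x\<bar> \<le> k"
  then obtain k where k: "\<forall>x\<in>S. \<bar>x\<bar> \<le> k" by blast
  have "S \<subseteq> {-k..k}" using k by (auto simp: abs_le_iff)
  then show "finite S" by (rule finite_subset) simp
qed

lemma pred_less_nat: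
  fixes f g :: "'a \<Rightarrow> nat"
  assumes [measurable]: "f \<in> measurable M (count_space UNIV)" "g \<in> measurable M (count_space UNIV)"
  shows "Measurable.pred M (\<lambda>x. f x < g x)"
proof -
  have "Measurable.pred M (\<lambda>x. \<exists>m n. m < n \<and> f x = m \<and> g x = n)" by measurable
  then show ?thesis by simp
qed

lemma pred_eq_nat:
  fixes f g :: "'a \<Rightarrow> nat"
  assumes [measurable]: "f \<in> measurable M (count_space UNIV)" "g \<in> measurable M (count_space UNIV)"
  shows "Measurable.pred M (\<lambda>x. f x = g x)"
proof -
  have "Measurable.pred M (\<lambda>x. \<exists>m. f x = m \<and> g x = m)" by measurable
  then show ?thesis by (simp add: eq_commute)
qed

text \<open>Sites outside \<open>I\<close> are never below anything, so they act as barriers and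
  every cluster of a site of \<open>I\<close> stays inside \<open>I\<close>. This gives a finite
  model whose law can be computed exactly.\<close>

definition before :: "int set \<Rightarrow> (int \<Rightarrow> nat \<Rightarrow> nat) \<Rightarrow> (int \<times> int) set" where
  "before I a = {(u, w) \<in> I \<times> I. less_fun (a u) (a w)}"

lemma trans_before: "trans (before I a)"
  by (auto simp: before_def trans_def intro: less_fun_trans)

lemma irrefl_before: "irrefl (before I a)"
  by (auto simp: before_def irrefl_def less_fun_irrefl)

lemma before_total:
  assumes "u \<in> I" "w \<in> I" "a u \<noteq> a w"
  shows "(u, w) \<in> before I a \<or> (w, u) \<in> before I a"
proof -
  define k where "k = (LEAST k. a u k \<noteq> a w k)"
  have "\<exists>k. a u k \<noteq> a w k" using assms(3) by (auto simp: fun_eq_iff)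
  then have k: "a u k \<noteq> a w k" "\<And>j. j < k \<Longrightarrow> a u j = a w j"
    unfolding k_def by (rule LeastI_ex) (use not_less_Least in blast)
  from k(1) have "less_fun (a u) (a w) \<or> less_fun (a w) (a u)"
    using k(2) by (metis less_fun_def linorder_neq_iff)
  then show ?thesis using assms(1,2) by (auto simp: before_def)
qed

lemma pred_before:
  assumes [measurable]: "\<And>v k. (\<lambda>\<omega>. a \<omega> v k) \<in> measurable M (count_space UNIV)"
  shows "Measurable.pred M (\<lambda>\<omega>. (u, w) \<in> before I (a \<omega>))"
proof -
  note pred_less_nat [measurable] pred_eq_nat [measurable]
  have "Measurable.pred M (\<lambda>\<omega>. u \<in> I \<and> w \<in> I \<and> (\<exists>k. a \<omega> u k < a \<omega> w k \<and> (\<forall>j. j < k \<longrightarrow> a \<omega> u j = a \<omega> w j)))"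
    by measurable
  then show ?thesis by (simp add: before_def less_fun_def)
qed

lemma pred_before_eq:
  assumes "\<And>v k. (\<lambda>\<omega>. a \<omega> v k) \<in> measurable M (count_space UNIV)"
  shows "Measurable.pred M (\<lambda>\<omega>. before I (a \<omega>) = r)"
proof -
  note [measurable] = pred_before[OF assms]
  have "Measurable.pred M (\<lambda>\<omega>. \<forall>u w. (u, w) \<in> before I (a \<omega>) \<longleftrightarrow> (u, w) \<in> r)" by measurable
  also have "(\<lambda>\<omega>. \<forall>u w. (u, w) \<in> before I (a \<omega>) \<longleftrightarrow> (u, w) \<in> r) = (\<lambda>\<omega>. before I (a \<omega>) = r)"
    by (auto simp: fun_eq_iff set_eq_iff)
  finally show ?thesis .
qed

lemma pred_cluster:
  assumes "\<And>v k. (\<lambda>\<omega>. a \<omega> v k) \<in> measurable M (count_space UNIV)"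
  shows "Measurable.pred M (\<lambda>\<omega>. u \<in> cluster (before I (a \<omega>)) v)"
proof -
  note [measurable] = pred_before[OF assms]
  have "Measurable.pred M (\<lambda>\<omega>. \<forall>w. w \<in> {min u v..max u v} \<longrightarrow> w \<noteq> v \<longrightarrow> (w, v) \<in> before I (a \<omega>))"
    by measurable
  then show ?thesis by (simp add: cluster_def Ball_def)
qed

lemma pred_cluster_eq:
  assumes "\<And>v k. (\<lambda>\<omega>. a \<omega> v k) \<in> measurable M (count_space UNIV)"
  shows "Measurable.pred M (\<lambda>\<omega>. cluster (before I (a \<omega>)) v = K)"
proof -
  note [measurable] = pred_cluster[OF assms]
  have "Measurable.pred M (\<lambda>\<omega>. \<forall>u. u \<in> cluster (before I (a \<omega>)) v \<longleftrightarrow> u \<in> K)" by measurable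
  also have "(\<lambda>\<omega>. \<forall>u. u \<in> cluster (before I (a \<omega>)) v \<longleftrightarrow> u \<in> K) = (\<lambda>\<omega>. cluster (before I (a \<omega>)) v = K)"
    by (auto simp: fun_eq_iff set_eq_iff)
  finally show ?thesis .
qed

text \<open>Both the finite clusters and the values on them range over countable sets, so each round
  is a countable case distinction.\<close>

lemma (in sampling_rule) measurable_sampled:
  assumes a [measurable]: "\<And>v k. (\<lambda>\<omega>. a \<omega> v k) \<in> measurable M (count_space UNIV)"
    and w [measurable]: "\<And>v k. (\<lambda>\<omega>. w \<omega> v k) \<in> measurable M (count_space UNIV)"
  shows "(\<lambda>\<omega>. sampled g (before I (a \<omega>)) (w \<omega>) v) \<in> measurable M (count_space UNIV)"
proof -
  \<comment> \<open>The empty set marks an infinite cluster. This is unambiguous because a cluster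
    contains its own site.\<close>
  define Cl where "Cl \<omega> v = (let K = cluster (before I (a \<omega>)) v in if finite K then K else {})" for \<omega> v
  have Cl_eq: "Cl \<omega> v = (if finite (cluster (before I (a \<omega>)) v) then cluster (before I (a \<omega>)) v else {})" for \<omega> v
    by (simp add: Cl_def Let_def)
  have Cl_empty: "Cl \<omega> v = {} \<longleftrightarrow> infinite (cluster (before I (a \<omega>)) v)" for \<omega> v
    using self_in_cluster[of v "before I (a \<omega>)"] by (auto simp: Cl_eq simp del: self_in_cluster)
  have fin: "Cl \<omega> v \<in> {K. finite K}" for \<omega> v by (simp add: Cl_eq)
  have cF: "countable {K :: int set. finite K}" by (rule countable_Collect_finite)
  have pK: "Measurable.pred M (\<lambda>\<omega>. Cl \<omega> v = K)" if "finite K" "K \<noteq> {}" for K v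
  proof -
    have "(\<lambda>\<omega>. Cl \<omega> v = K) = (\<lambda>\<omega>. cluster (before I (a \<omega>)) v = K)"
      using that by (auto simp: fun_eq_iff Cl_eq)
    then show ?thesis using pred_cluster_eq[OF a] by simp
  qed
  have pE: "Measurable.pred M (\<lambda>\<omega>. Cl \<omega> v = {})" for v
  proof -
    note [measurable] = pred_cluster[OF a]
    have "Measurable.pred M (\<lambda>\<omega>. \<not> (\<exists>k. \<forall>u. u \<in> cluster (before I (a \<omega>)) v \<longrightarrow> \<bar>u\<bar> \<le> k))"
      by measurable
    then show ?thesis by (simp add: Cl_empty finite_int_iff_bounded Ball_def)
  qed
  have Cl: "(\<lambda>\<omega>. Cl \<omega> v) \<in> measurable M (count_space {K. finite K})" for v
    unfolding measurable_count_space_eq_countable[OF cF]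
  proof (intro conjI ballI)
    fix K :: "int set" assume "K \<in> {K. finite K}"
    then have "Measurable.pred M (\<lambda>\<omega>. Cl \<omega> v = K)" using pK pE by (cases "K = {}") auto
    then show "(\<lambda>\<omega>. Cl \<omega> v) -` {K} \<inter> space M \<in> sets M"
      by (simp add: pred_def vimage_def Int_def conj_commute)
  qed (use fin in auto)
  have step: "(\<lambda>\<omega>. stage g (before I (a \<omega>)) (w \<omega>) n v) \<in> measurable M (count_space UNIV)" for n v
  proof (induction n arbitrary: v)
    case (Suc n)
    have 1: "(\<lambda>\<omega>. w \<omega> v (g v (K - {v}) (restrict (stage g (before I (a \<omega>)) (w \<omega>) n) (K - {v}))))
        \<in> measurable M (count_space UNIV)" if "finite K" for K
    proof (rule measurable_compose_countable'[where I = "PiE (K - {v}) (\<lambda>_. UNIV)"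
          and f = "\<lambda>x \<omega>. w \<omega> v (g v (K - {v}) x)"])
      show "countable (PiE (K - {v}) (\<lambda>_. UNIV :: nat set))"
        using that by (intro countable_PiE) auto
      have "(\<lambda>\<omega>. restrict (stage g (before I (a \<omega>)) (w \<omega>) n) (K - {v}))
          \<in> measurable M (Pi\<^sub>M (K - {v}) (\<lambda>_. count_space UNIV))"
        using Suc by (intro measurable_restrict)
      then show "(\<lambda>\<omega>. restrict (stage g (before I (a \<omega>)) (w \<omega>) n) (K - {v}))
          \<in> measurable M (count_space (PiE (K - {v}) (\<lambda>_. UNIV)))"
        using that by (subst (asm) count_space_PiM_finite) auto
    qed (rule w)
    have "(\<lambda>\<omega>. if Cl \<omega> v = {} then 0 else
        w \<omega> v (g v (Cl \<omega> v - {v}) (restrict (stage g (before I (a \<omega>)) (w \<omega>) n) (Cl \<omega> v - {v}))))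
      \<in> measurable M (count_space UNIV)"
      by (intro measurable_If measurable_const measurable_compose_countable'[OF 1 Cl cF] pE[unfolded pred_def]) auto
    also have "(\<lambda>\<omega>. if Cl \<omega> v = {} then 0 else
        w \<omega> v (g v (Cl \<omega> v - {v}) (restrict (stage g (before I (a \<omega>)) (w \<omega>) n) (Cl \<omega> v - {v}))))
      = (\<lambda>\<omega>. stage g (before I (a \<omega>)) (w \<omega>) (Suc n) v)"
    proof
      fix \<omega>
      have "g v (K - {v}) (restrict x (K - {v})) = g v (K - {v}) x" for K and x :: "int \<Rightarrow> nat"
        by (intro rule_cong) simp
      then show "(if Cl \<omega> v = {} then 0 else
          w \<omega> v (g v (Cl \<omega> v - {v}) (restrict (stage g (before I (a \<omega>)) (w \<omega>) n) (Cl \<omega> v - {v}))))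
        = stage g (before I (a \<omega>)) (w \<omega>) (Suc n) v"
        by (cases "Cl \<omega> v = {}") (simp_all add: Cl_empty, simp add: Cl_eq)
    qed
    finally show ?case .
  qed simp
  have card: "(\<lambda>\<omega>. card (Cl \<omega> v)) \<in> measurable M (count_space UNIV)"
    by (rule measurable_compose[OF Cl]) simp
  have "(\<lambda>\<omega>. stage g (before I (a \<omega>)) (w \<omega>) (card (Cl \<omega> v)) v) \<in> measurable M (count_space UNIV)"
    by (rule measurable_compose_countable[OF step card])
  moreover have "card (Cl \<omega> v) = card (cluster (before I (a \<omega>)) v)" for \<omega> by (simp add: Cl_eq)
  ultimately show ?thesis by (simp add: sampled_def)
qed

section \<open>The driving noise\<close>

locale noise = product_prob_space q "UNIV :: nat set" for q :: "nat \<Rightarrow> nat measure" +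
  assumes sets_q [measurable_cong]: "sets (q k) = UNIV"
begin

definition noise :: "(int \<Rightarrow> nat \<Rightarrow> nat) measure" where
  "noise = Pi\<^sub>M UNIV (\<lambda>_. Pi\<^sub>M UNIV q)"

lemma space_q: "space (q k) = UNIV"
  using sets_eq_imp_space_eq[of "q k" "count_space UNIV"] by (simp add: sets_q)

lemma space_site: "space (Pi\<^sub>M UNIV q) = UNIV"
  by (simp add: space_PiM space_q)

sublocale field: product_prob_space "\<lambda>_::int. Pi\<^sub>M UNIV q" UNIV
  by unfold_locales

sublocale N: prob_space noise
  unfolding noise_def by unfold_locales

lemma space_noise: "space noise = UNIV"
  by (simp add: noise_def space_PiM space_q)

lemma measurable_site [measurable]: "(\<lambda>f. f k) \<in> measurable (Pi\<^sub>M UNIV q) (count_space UNIV)"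
proof -
  have "(\<lambda>f. f k) \<in> measurable (Pi\<^sub>M UNIV q) (q k)" by simp
  also have "measurable (Pi\<^sub>M UNIV q) (q k) = measurable (Pi\<^sub>M UNIV q) (count_space UNIV)"
    by (rule measurable_cong_sets) (simp_all add: sets_q)
  finally show ?thesis .
qed

lemma measurable_noise [measurable]: "(\<lambda>\<omega>. \<omega> v) \<in> measurable noise (Pi\<^sub>M UNIV q)"
  unfolding noise_def by simp

lemma measurable_noise' [measurable]: "(\<lambda>\<omega>. \<omega> v k) \<in> measurable noise (count_space UNIV)"
  by (rule measurable_compose[OF measurable_noise measurable_site])

lemma prob_rectangle:
  assumes V: "finite V" and J: "\<And>v. v \<in> V \<Longrightarrow> finite (J v)"
  shows "measure noise {\<omega>. \<forall>v\<in>V. \<forall>k\<in>J v. \<omega> v k \<in> A v k} = (\<Prod>v\<in>V. \<Prod>k\<in>J v. measure (q k) (A v k))"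
proof -
  have 1: "measure (Pi\<^sub>M UNIV q) {f. \<forall>k\<in>J. f k \<in> A k} = (\<Prod>k\<in>J. measure (q k) (A k))"
    if "finite J" for J A
  proof -
    have "emeasure (Pi\<^sub>M UNIV q) {f \<in> space (Pi\<^sub>M UNIV q). \<forall>k\<in>J. f k \<in> A k} = (\<Prod>k\<in>J. emeasure (q k) (A k))"
      using that by (intro emeasure_PiM_Collect) (auto simp: sets_q)
    then show ?thesis
      by (simp add: space_site P.emeasure_eq_measure M.emeasure_eq_measure prod_ennreal prod_nonneg)
  qed
  have "emeasure noise {\<omega> \<in> space noise. \<forall>v\<in>V. \<omega> v \<in> {f. \<forall>k\<in>J v. f k \<in> A v k}}
      = (\<Prod>v\<in>V. emeasure (Pi\<^sub>M UNIV q) {f. \<forall>k\<in>J v. f k \<in> A v k})"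
    unfolding noise_def
  proof (rule field.emeasure_PiM_Collect)
    fix v assume "v \<in> V"
    then have [simp]: "finite (J v)" by (rule J)
    have "Measurable.pred (Pi\<^sub>M UNIV q) (\<lambda>f. \<forall>k\<in>J v. f k \<in> A v k)" by measurable
    then show "{f. \<forall>k\<in>J v. f k \<in> A v k} \<in> sets (Pi\<^sub>M UNIV q)" by (simp add: pred_def space_site)
  qed (use V in auto)
  also have "\<dots> = (\<Prod>v\<in>V. ennreal (\<Prod>k\<in>J v. measure (q k) (A v k)))"
    by (intro prod.cong refl) (simp add: P.emeasure_eq_measure 1 J)
  finally show ?thesis
    by (simp add: space_noise N.emeasure_eq_measure prod_ennreal prod_nonneg)
qed

text \<open>Flattens the nested product into one family indexed by pairs of site and digit, so that
  digits can later be grouped by parity.\<close>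

lemma indep_coordinates: "N.indep_vars (\<lambda>_. count_space UNIV) (\<lambda>p \<omega>. \<omega> (fst p) (snd p)) UNIV"
  unfolding N.indep_vars_def2
proof (intro conjI ballI N.indep_setsI)
  fix A :: "int \<times> nat \<Rightarrow> _" and J :: "(int \<times> nat) set"
  assume J: "finite J"
    and A: "\<forall>j\<in>J. A j \<in> {(\<lambda>\<omega>. \<omega> (fst j) (snd j)) -` A \<inter> space noise |A. A \<in> sets (count_space UNIV)}"
  then obtain B where B: "\<And>j. j \<in> J \<Longrightarrow> A j = {\<omega>. \<omega> (fst j) (snd j) \<in> B j}"
    by (simp add: space_noise vimage_def) metis
  have Jv: "finite {k. (v, k) \<in> J}" for v
    using J by (rule finite_surj[of _ _ snd]) force
  have sig: "Sigma (fst ` J) (\<lambda>v. {k. (v, k) \<in> J}) = J" by force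
  have single: "measure noise {\<omega>. \<omega> v k \<in> C} = measure (q k) C" for v k C
    using prob_rectangle[of "{v}" "\<lambda>_. {k}" "\<lambda>_ _. C"] by simp
  have "(\<Inter>j\<in>J. A j) = {\<omega>. \<forall>v\<in>fst ` J. \<forall>k\<in>{k. (v, k) \<in> J}. \<omega> v k \<in> B (v, k)}"
    using B by fastforce
  then have "measure noise (\<Inter>j\<in>J. A j) = (\<Prod>v\<in>fst ` J. \<Prod>k\<in>{k. (v, k) \<in> J}. measure (q k) (B (v, k)))"
    using prob_rectangle[of "fst ` J" "\<lambda>v. {k. (v, k) \<in> J}" "\<lambda>v k. B (v, k)"] J Jv
    by (simp only: finite_imageI)
  also have "\<dots> = (\<Prod>(v, k)\<in>J. measure (q k) (B (v, k)))"
    using J Jv by (subst prod.Sigma) (auto simp: sig)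
  also have "\<dots> = (\<Prod>j\<in>J. measure noise (A j))"
    by (intro prod.cong) (auto simp: B single)
  finally show "measure noise (\<Inter>j\<in>J. A j) = (\<Prod>j\<in>J. measure noise (A j))" .
qed auto

lemma noise_reindex:
  assumes "inj f"
  shows "distr noise noise (\<lambda>\<omega> i. \<omega> (f i)) = noise"
  using distr_PiM_reindex[of UNIV "\<lambda>_. Pi\<^sub>M UNIV q" f UNIV] assms P.prob_space_axioms
  by (simp add: noise_def restrict_def)

end

section \<open>Labels, record events and the tail of the cluster size\<close>

definition labels :: "(int \<Rightarrow> nat \<Rightarrow> nat) \<Rightarrow> int \<Rightarrow> nat \<Rightarrow> nat" where
  "labels \<omega> v k = \<omega> v (2 * k)"

definition samples :: "(int \<Rightarrow> nat \<Rightarrow> nat) \<Rightarrow> int \<Rightarrow> nat \<Rightarrow> nat" where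
  "samples \<omega> v k = \<omega> v (2 * k + 1)"

text \<open>On one of the two sides of \<open>v\<close>, no site within distance \<open>n\<close>
  stops the cluster. Off this event there is a barrier on each side, whichever window the order is
  restricted to.\<close>

definition unblocked :: "int \<Rightarrow> nat \<Rightarrow> (int \<Rightarrow> nat \<Rightarrow> nat) set" where
  "unblocked v n = {\<omega>. \<forall>u\<in>{v - int n..v + int n} \<inter> {v<..}. less_fun (labels \<omega> u) (labels \<omega> v)}
     \<union> {\<omega>. \<forall>u\<in>{v - int n..v + int n} \<inter> {..<v}. less_fun (labels \<omega> u) (labels \<omega> v)}"

lemma blocked_cluster:
  assumes "\<omega> \<notin> unblocked v n"
  obtains a b where "a < v" "v < b" "v - int n \<le> a" "b \<le> v + int n"
    "\<not> less_fun (labels \<omega> a) (labels \<omega> v)" "\<not> less_fun (labels \<omega> b) (labels \<omega> v)"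
  using assms unfolding unblocked_def by auto

lemma cluster_between:
  assumes "a < v" "v < b" "\<not> less_fun (labels \<omega> a) (labels \<omega> v)" "\<not> less_fun (labels \<omega> b) (labels \<omega> v)"
  shows "cluster (before I (labels \<omega>)) v \<subseteq> {a<..<b}"
proof
  fix u assume u: "u \<in> cluster (before I (labels \<omega>)) v"
  have "u > a"
  proof (rule ccontr)
    assume "\<not> u > a"
    then have "a \<in> {min u v..max u v}" "a \<noteq> v" using assms(1) by auto
    then have "(a, v) \<in> before I (labels \<omega>)" using u unfolding cluster_def by blast
    then show False using assms(3) by (simp add: before_def)
  qed
  moreover have "u < b"
  proof (rule ccontr)
    assume "\<not> u < b"
    then have "b \<in> {min u v..max u v}" "b \<noteq> v" using assms(2) by auto
    then have "(b, v) \<in> before I (labels \<omega>)" using u unfolding cluster_def by blast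
    then show False using assms(4) by (simp add: before_def)
  qed
  ultimately show "u \<in> {a<..<b}" by simp
qed

lemma cluster_subset_window:
  assumes "\<omega> \<notin> unblocked v n"
  shows "cluster (before I (labels \<omega>)) v \<subseteq> {v - int n..v + int n}"
proof -
  obtain a b where "a < v" "v < b" "v - int n \<le> a" "b \<le> v + int n"
    "\<not> less_fun (labels \<omega> a) (labels \<omega> v)" "\<not> less_fun (labels \<omega> b) (labels \<omega> v)"
    by (rule blocked_cluster[OF assms])
  then show ?thesis using cluster_between[of a v b \<omega> I] by (auto dest!: subsetD)
qed

context noise
begin

lemma measurable_labels [measurable]: "(\<lambda>\<omega>. labels \<omega> v k) \<in> measurable noise (count_space UNIV)"
  unfolding labels_def by measurable

lemma measurable_samples [measurable]: "(\<lambda>\<omega>. samples \<omega> v k) \<in> measurable noise (count_space UNIV)"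
  unfolding samples_def by measurable

lemma sets_before_eq [measurable]: "{\<omega>. before I (labels \<omega>) = r} \<in> sets noise"
  using pred_before_eq[OF measurable_labels, where I = I and r = r] by (simp add: pred_def space_noise)

lemma sets_record: "{\<omega>. \<forall>u\<in>F. less_fun (labels \<omega> u) (labels \<omega> v)} \<in> sets noise"
proof -
  have [measurable]: "Measurable.pred noise (\<lambda>\<omega>. less_fun (labels \<omega> u) (labels \<omega> v))" for u
    using pred_before[OF measurable_labels, where u = u and w = v and I = UNIV] by (simp add: before_def)
  have "Measurable.pred noise (\<lambda>\<omega>. \<forall>u. u \<in> F \<longrightarrow> less_fun (labels \<omega> u) (labels \<omega> v))" by measurable
  then show ?thesis by (simp add: pred_def space_noise Ball_def)
qed

text \<open>By exchangeability each site of \<open>F\<close> is equally likely to carry the strict maximum.\<close>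

lemma record_prob:
  assumes "finite F" "v \<in> F"
  shows "measure noise {\<omega>. \<forall>u\<in>F - {v}. less_fun (labels \<omega> u) (labels \<omega> v)} \<le> 1 / card F"
proof -
  define E where "E j = {\<omega>. \<forall>u\<in>F - {j}. less_fun (labels \<omega> u) (labels \<omega> j)}" for j
  have sets: "E j \<in> sets noise" for j
    unfolding E_def by (rule sets_record)
  have eq: "measure noise (E j) = measure noise (E v)" if "j \<in> F" for j
  proof -
    \<comment> \<open>Exchanging the sites \<open>j\<close> and \<open>v\<close> preserves the law
      of the noise and turns the record event of one into that of the other.\<close>
    define f where "f = Transposition.transpose j v"
    have inj: "inj f" and fv: "f v = j" and img: "f ` (F - {v}) = F - {j}"
      using that assms(2) unfolding f_def by (auto simp: transpose_image_eq image_set_diff)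
    have lf: "labels (\<lambda>i. \<omega> (f i)) u = labels \<omega> (f u)" for \<omega> u
      by (simp add: labels_def fun_eq_iff)
    have meas: "(\<lambda>\<omega> i. \<omega> (f i)) \<in> measurable noise noise"
      unfolding noise_def
      by (intro measurable_PiM_single' measurable_component_singleton) (auto simp: space_PiM)
    have "measure noise (E v) = measure (distr noise noise (\<lambda>\<omega> i. \<omega> (f i))) (E v)"
      by (simp only: noise_reindex[OF inj])
    also have "\<dots> = measure noise ((\<lambda>\<omega> i. \<omega> (f i)) -` E v \<inter> space noise)"
      by (rule measure_distr[OF meas sets])
    also have "(\<lambda>\<omega> i. \<omega> (f i)) -` E v \<inter> space noise = E j"
      unfolding E_def img[symmetric] by (simp add: space_noise lf fv vimage_def)
    finally show ?thesis ..
  qed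
  have "disjoint_family_on E F"
    unfolding disjoint_family_on_def
  proof (intro ballI impI)
    fix i j assume ij: "i \<in> F" "j \<in> F" "i \<noteq> j"
    { fix \<omega> assume "\<omega> \<in> E i" "\<omega> \<in> E j"
      then have "less_fun (labels \<omega> j) (labels \<omega> i)" "less_fun (labels \<omega> i) (labels \<omega> j)"
        using ij by (auto simp: E_def)
      then have False using less_fun_asym by blast }
    then show "E i \<inter> E j = {}" by blast
  qed
  then have "measure noise (\<Union>j\<in>F. E j) = (\<Sum>j\<in>F. measure noise (E j))"
    using assms(1) sets by (intro N.finite_measure_finite_Union) auto
  also have "\<dots> = card F * measure noise (E v)"
    using eq by simp
  finally have "card F * measure noise (E v) \<le> 1"
    using N.prob_le_1 by metis
  moreover have "card F > 0" using assms card_gt_0_iff by blast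
  ultimately have "measure noise (E v) \<le> 1 / card F"
    by (simp add: field_simps)
  then show ?thesis by (simp add: E_def)
qed

lemma sets_unblocked [measurable]: "unblocked v n \<in> sets noise"
  unfolding unblocked_def by (intro sets.Un sets_record)

text \<open>Each one-sided event makes \<open>v\<close> a strict record among \<open>n + 1\<close>
  consecutive sites; the union bound supplies the 2.\<close>

lemma prob_unblocked: "measure noise (unblocked v n) \<le> 2 / real (n + 1)"
proof -
  let ?R = "{\<omega>. \<forall>u\<in>{v - int n..v + int n} \<inter> {v<..}. less_fun (labels \<omega> u) (labels \<omega> v)}"
  let ?L = "{\<omega>. \<forall>u\<in>{v - int n..v + int n} \<inter> {..<v}. less_fun (labels \<omega> u) (labels \<omega> v)}"
  have R: "{v - int n..v + int n} \<inter> {v<..} = {v..v + int n} - {v}" by auto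
  have L: "{v - int n..v + int n} \<inter> {..<v} = {v - int n..v} - {v}" by auto
  have "card {v..v + int n} = n + 1" "card {v - int n..v} = n + 1" by auto
  then have "measure noise ?R \<le> 1 / real (n + 1)" "measure noise ?L \<le> 1 / real (n + 1)"
    unfolding R L using record_prob[of "{v..v + int n}" v] record_prob[of "{v - int n..v}" v] by auto
  moreover have "measure noise (unblocked v n) \<le> measure noise ?R + measure noise ?L"
    unfolding unblocked_def by (rule measure_Un_le) (rule sets_record)+
  moreover have "2 / real (n + 1) = 1 / real (n + 1) + 1 / real (n + 1)" by simp
  ultimately show ?thesis by linarith
qed

lemma AE_blocked: "AE \<omega> in noise. \<exists>n. \<omega> \<notin> unblocked v n"
proof -
  have "measure noise (\<Inter>n. unblocked v n) \<le> 2 / real (n + 1)" for n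
    using N.finite_measure_mono[of "\<Inter>n. unblocked v n" "unblocked v n"] prob_unblocked[of v n]
    by (force intro: order_trans)
  moreover have "(\<lambda>n. 2 / real (n + 1)) \<longlonglongrightarrow> 0" by real_asymp
  ultimately have "measure noise (\<Inter>n. unblocked v n) \<le> 0"
    by (intro LIMSEQ_le_const[of _ 0]) auto
  then have "(\<Inter>n. unblocked v n) \<in> null_sets noise"
    by (auto simp: null_sets_def N.emeasure_eq_measure measure_le_0_iff)
  then show ?thesis by (rule AE_I') (auto simp: space_noise)
qed

text \<open>Labels occupy the even digits and samples the odd ones. The indices \<open>j\<close> are
  deterministic here, which is why the order is first fixed to be \<open>r\<close>.\<close>

lemma label_sample_indep:
  assumes "finite I"
  shows "measure noise ({\<omega>. before I (labels \<omega>) = r} \<inter> {\<omega>. \<forall>u\<in>I. samples \<omega> u (j u) = x u})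
    = measure noise {\<omega>. before I (labels \<omega>) = r} * (\<Prod>u\<in>I. measure (q (2 * j u + 1)) {x u})"
proof -
  let ?E = "UNIV \<times> {k. even k} :: (int \<times> nat) set" and ?O = "UNIV \<times> {k. odd k} :: (int \<times> nat) set"
  let ?c = "\<lambda>_. count_space UNIV :: nat measure"
  have "N.indep_var (PiM ?E ?c) (\<lambda>\<omega>. \<lambda>p\<in>?E. \<omega> (fst p) (snd p)) (PiM ?O ?c) (\<lambda>\<omega>. \<lambda>p\<in>?O. \<omega> (fst p) (snd p))"
    by (rule N.indep_var_restrict[OF indep_coordinates]) auto
  note ind = N.indep_varD[OF this]
  define A where "A = {z \<in> space (PiM ?E ?c). before I (\<lambda>v k. z (v, 2 * k)) = r}"
  define B where "B = {z \<in> space (PiM ?O ?c). \<forall>u\<in>I. z (u, 2 * j u + 1) = x u}"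
  have "(\<lambda>z. z (v, 2 * k)) \<in> measurable (PiM ?E ?c) (count_space UNIV)" for v k
    by (rule measurable_component_singleton) auto
  note pred_before_eq[OF this, where I = I and r = r]
  then have A: "A \<in> sets (PiM ?E ?c)" by (simp add: A_def pred_def)
  have 1 [measurable]: "(\<lambda>z. z (u, 2 * j u + 1)) \<in> measurable (PiM ?O ?c) (count_space UNIV)" for u
    by (rule measurable_component_singleton) auto
  have "Measurable.pred (PiM ?O ?c) (\<lambda>z. \<forall>u. u \<in> I \<longrightarrow> z (u, 2 * j u + 1) = x u)"
    by measurable
  then have B: "B \<in> sets (PiM ?O ?c)" by (simp add: B_def pred_def Ball_def)
  have lab: "labels \<omega> = (\<lambda>v k. \<omega> v (2 * k))" for \<omega> by (intro ext) (simp add: labels_def)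
  have vA: "(\<lambda>\<omega>. \<lambda>p\<in>?E. \<omega> (fst p) (snd p)) -` A \<inter> space noise = {\<omega>. before I (labels \<omega>) = r}"
    by (simp add: A_def space_noise vimage_def space_PiM lab)
  have vB: "(\<lambda>\<omega>. \<lambda>p\<in>?O. \<omega> (fst p) (snd p)) -` B \<inter> space noise = {\<omega>. \<forall>u\<in>I. samples \<omega> u (j u) = x u}"
    by (simp add: B_def space_noise vimage_def space_PiM samples_def)
  have vAB: "(\<lambda>\<omega>. ((\<lambda>p\<in>?E. \<omega> (fst p) (snd p)), (\<lambda>p\<in>?O. \<omega> (fst p) (snd p)))) -` (A \<times> B) \<inter> space noise
    = {\<omega>. before I (labels \<omega>) = r} \<inter> {\<omega>. \<forall>u\<in>I. samples \<omega> u (j u) = x u}"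
    unfolding vA[symmetric] vB[symmetric] by blast
  have "measure noise {\<omega>. \<forall>u\<in>I. samples \<omega> u (j u) = x u} = (\<Prod>u\<in>I. measure (q (2 * j u + 1)) {x u})"
    using prob_rectangle[of I "\<lambda>u. {2 * j u + 1}" "\<lambda>u _. {x u}"] assms by (simp add: samples_def)
  then show ?thesis using ind[OF A B] by (simp add: vA vB vAB)
qed

end

section \<open>The law of the sampled field\<close>

context one_dependent_law
begin

definition laws :: "nat measure set" where
  "laws = {cond_law v K x |v K x. finite K}"

definition law_index :: "int \<Rightarrow> int set \<Rightarrow> (int \<Rightarrow> nat) \<Rightarrow> nat" where
  "law_index v K x = to_nat_on laws (cond_law v K x)"

text \<open>Even digits form the label; they are uniform on growing sets so that ties have probability 0.
  Odd digits are the samples from the conditional laws.\<close>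

definition digit_law :: "nat \<Rightarrow> nat measure" where
  "digit_law k = (if even k then measure_pmf (pmf_of_set {0..k div 2}) else from_nat_into laws (k div 2))"

lemma laws_nonempty: "laws \<noteq> {}"
  unfolding laws_def by blast

lemma digit_law_index:
  assumes "finite K"
  shows "digit_law (2 * law_index v K x + 1) = cond_law v K x"
proof -
  have "cond_law v K x \<in> laws" using assms by (auto simp: laws_def)
  then show ?thesis
    using countable_cond_laws from_nat_into_to_nat_on[of laws "cond_law v K x"]
    by (simp add: digit_law_def law_index_def laws_def)
qed

lemma digit_law_cases:
  "(\<exists>p. digit_law k = measure_pmf p) \<or> (\<exists>v K x. finite K \<and> digit_law k = cond_law v K x)"
proof (cases "even k")
  case False
  have "from_nat_into laws (k div 2) \<in> laws" by (rule from_nat_into[OF laws_nonempty])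
  then show ?thesis using False by (auto simp: digit_law_def laws_def)
qed (auto simp: digit_law_def)

lemma prob_space_digit_law: "prob_space (digit_law k)"
  using digit_law_cases[of k] prob_space_cond_law by (auto intro: measure_pmf.prob_space_axioms)

lemma sets_digit_law: "sets (digit_law k) = UNIV"
  using digit_law_cases[of k] by (auto simp: sets_cond_law)

sublocale Z: noise digit_law
proof -
  interpret product_prob_space digit_law "UNIV :: nat set"
    by (rule product_prob_spaceI) (rule prob_space_digit_law)
  show "noise digit_law"
    by unfold_locales (rule sets_digit_law)
qed

sublocale R: sampling_rule law_index
proof
  fix v K and x y :: "int \<Rightarrow> nat"
  assume "\<And>u. u \<in> K \<Longrightarrow> x u = y u"
  then have "cond_law v K x = cond_law v K y" by (rule cond_law_cong)
  then show "law_index v K x = law_index v K y" by (simp only: law_index_def)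
qed

definition coded :: "int set \<Rightarrow> (int \<Rightarrow> nat \<Rightarrow> nat) \<Rightarrow> int \<Rightarrow> nat" where
  "coded I \<omega> = sampled law_index (before I (labels \<omega>)) (samples \<omega>)"

text \<open>A tie forces agreement in digit \<open>2 * k\<close>, which is uniform on
  \<open>k + 1\<close> values, so its probability is at most \<open>1 / (k + 1)\<close> for every
  \<open>k\<close>.\<close>

lemma AE_no_ties: "AE \<omega> in Z.noise. \<forall>u v. u \<noteq> v \<longrightarrow> labels \<omega> u \<noteq> labels \<omega> v"
proof -
  have "AE \<omega> in Z.noise. labels \<omega> u \<noteq> labels \<omega> v" if "u \<noteq> v" for u v
  proof -
    note pred_eq_nat [measurable]
    have [measurable]: "Measurable.pred Z.noise (\<lambda>\<omega>. labels \<omega> u = labels \<omega> v)"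
      unfolding fun_eq_iff by measurable
    let ?T = "{\<omega>. labels \<omega> u = labels \<omega> v}"
    have T: "?T \<in> sets Z.noise"
      using \<open>Measurable.pred _ _\<close> by (simp add: pred_def Z.space_noise)
    have "measure Z.noise ?T \<le> 1 / real (k + 1)" for k
    proof -
      define D where "D m = {\<omega>. \<forall>i\<in>{u, v}. \<forall>l\<in>{2 * k}. \<omega> i l \<in> {m::nat}}" for m
      \<comment> \<open>Digits are arbitrary natural numbers on the sample space; values beyond the
        support \<open>{0..k}\<close> are collected in this null event.\<close>
      define O' where "O' = {\<omega>. \<forall>i\<in>{u}. \<forall>l\<in>{2 * k}. \<omega> i l \<in> {k<..}}"
      have pred: "Measurable.pred Z.noise (\<lambda>\<omega>. \<omega> u (2 * k) = m \<and> \<omega> v (2 * k) = m)"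
        "Measurable.pred Z.noise (\<lambda>\<omega>. k < \<omega> u (2 * k))" for m
        by measurable
      have sD: "D m \<in> sets Z.noise" for m
        using pred(1)[of m] by (simp add: D_def pred_def Z.space_noise)
      have sO: "O' \<in> sets Z.noise"
        using pred(2) by (simp add: O'_def pred_def Z.space_noise)
      have "measure Z.noise (D m) = 1 / real (k + 1) ^ 2" if "m \<in> {0..k}" for m
        using Z.prob_rectangle[of "{u, v}" "\<lambda>_. {2 * k}" "\<lambda>_ _. {m}"] \<open>u \<noteq> v\<close> that
        by (simp add: D_def digit_law_def measure_pmf_single power2_eq_square)
      then have "(\<Sum>m\<in>{0..k}. measure Z.noise (D m)) = 1 / real (k + 1)"
        by (simp add: power2_eq_square)
      moreover have "{0..k} \<inter> {k<..} = {}" by auto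
      then have "measure Z.noise O' = 0"
        using Z.prob_rectangle[of "{u}" "\<lambda>_. {2 * k}" "\<lambda>_ _. {k<..}"]
        by (simp add: O'_def digit_law_def measure_pmf_of_set)
      moreover have "measure Z.noise (\<Union>m\<in>{0..k}. D m) \<le> (\<Sum>m\<in>{0..k}. measure Z.noise (D m))"
        using sD by (intro measure_UNION_le) auto
      moreover have "measure Z.noise ((\<Union>m\<in>{0..k}. D m) \<union> O')
          \<le> measure Z.noise (\<Union>m\<in>{0..k}. D m) + measure Z.noise O'"
        using sD sO by (intro measure_Un_le) auto
      moreover have "measure Z.noise ?T \<le> measure Z.noise ((\<Union>m\<in>{0..k}. D m) \<union> O')"
      proof (rule Z.N.finite_measure_mono)
        show "?T \<subseteq> (\<Union>m\<in>{0..k}. D m) \<union> O'"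
        proof
          fix \<omega> assume "\<omega> \<in> ?T"
          then have "\<omega> u (2 * k) = \<omega> v (2 * k)" by (simp add: fun_eq_iff labels_def)
          then show "\<omega> \<in> (\<Union>m\<in>{0..k}. D m) \<union> O'"
            by (cases "\<omega> u (2 * k) \<le> k") (auto simp: D_def O'_def)
        qed
      qed (use sD sO in auto)
      ultimately show ?thesis by linarith
    qed
    moreover have "(\<lambda>k. 1 / real (k + 1)) \<longlonglongrightarrow> 0" by real_asymp
    ultimately have "measure Z.noise ?T \<le> 0"
      by (intro LIMSEQ_le_const[of _ 0]) auto
    then have "?T \<in> null_sets Z.noise"
      using T by (auto simp: null_sets_def Z.N.emeasure_eq_measure measure_le_0_iff)
    then show ?thesis by (rule AE_I') (auto simp: Z.space_noise)
  qed
  then show ?thesis by (simp add: AE_all_countable)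
qed

end

text \<open>Every site between \<open>z\<close> and \<open>u\<close> belongs to the cluster and
  hence to \<open>I\<close>, so no comparison used for the cluster is lost.\<close>

lemma cluster_before_window:
  assumes "cluster (before UNIV a) u \<subseteq> I"
  shows "cluster (before I a) u = cluster (before UNIV a) u"
proof
  show "cluster (before I a) u \<subseteq> cluster (before UNIV a) u"
    by (auto simp: cluster_def before_def)
  show "cluster (before UNIV a) u \<subseteq> cluster (before I a) u"
  proof
    fix z assume z: "z \<in> cluster (before UNIV a) u"
    show "z \<in> cluster (before I a) u"
      unfolding cluster_def
    proof clarify
      fix w assume w: "w \<in> {min z u..max z u}" "w \<noteq> u"
      then have "{min w u..max w u} \<subseteq> {min z u..max z u}" by auto
      then have "w \<in> cluster (before UNIV a) u" using z unfolding cluster_def by blast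
      then have "w \<in> I" using assms by blast
      moreover have "u \<in> I" using assms self_in_cluster by blast
      moreover have "(w, u) \<in> before UNIV a" using z w by (auto simp: cluster_def)
      ultimately show "(w, u) \<in> before I a" by (simp add: before_def)
    qed
  qed
qed

context one_dependent_law
begin

lemma measurable_coded [measurable]: "(\<lambda>\<omega>. coded I \<omega> v) \<in> measurable Z.noise (count_space UNIV)"
  unfolding coded_def by (rule R.measurable_sampled) measurable

text \<open>Clusters of sites in the cluster of \<open>v\<close> are contained in it, hence also in
  \<open>I\<close>, so the whole recursion at \<open>v\<close> takes place inside the
  window.\<close>

lemma coded_window:
  assumes "finite I" "cluster (before UNIV (labels \<omega>)) v \<subseteq> I"
  shows "coded I \<omega> v = coded UNIV \<omega> v"
  unfolding coded_def
proof (rule R.sampled_local)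
  show "finite (cluster (before UNIV (labels \<omega>)) v)" using assms by (rule finite_subset[rotated])
  show "cluster (before I (labels \<omega>)) u = cluster (before UNIV (labels \<omega>)) u"
    if "u \<in> cluster (before UNIV (labels \<omega>)) v" for u
    using cluster_subset[OF trans_before irrefl_before that] assms(2)
    by (intro cluster_before_window) auto
qed (auto intro: trans_before irrefl_before)

text \<open>Split according to the order \<open>r\<close> that the labels induce on
  \<open>I\<close>. Given \<open>r\<close>, independence of the samples and
  \<open>chain_rule\<close> yield the same conditional probability every time, so summing over
  \<open>r\<close> costs nothing.\<close>

lemma prob_coded_cyl:
  assumes I: "finite I"
  shows "measure Z.noise {\<omega>. \<forall>u\<in>I. coded I \<omega> u = x u} = measure P (cyl I x)"
proof -
  define E where "E r = {\<omega>. before I (labels \<omega>) = r}" for r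
  define j where "j r u = law_index u (cluster r u - {u}) x" for r u
  define B where "B r = {\<omega>. \<forall>u\<in>I. samples \<omega> u (j r u) = x u}" for r
  let ?R = "Pow (I \<times> I)"
  have E: "E r \<in> sets Z.noise" for r unfolding E_def by (rule Z.sets_before_eq)
  have "Measurable.pred Z.noise (\<lambda>\<omega>. \<forall>u. u \<in> I \<longrightarrow> samples \<omega> u (j r u) = x u)" for r
    by measurable
  then have B: "B r \<in> sets Z.noise" for r by (simp add: B_def pred_def Z.space_noise Ball_def)
  have sub: "before I (labels \<omega>) \<subseteq> I \<times> I" for \<omega> by (auto simp: before_def)
  have "{\<omega>. \<forall>u\<in>I. coded I \<omega> u = x u} = (\<Union>r\<in>?R. E r \<inter> B r)"
  proof (rule Set.set_eqI)
    fix \<omega>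
    have "(\<forall>u\<in>I. coded I \<omega> u = x u) \<longleftrightarrow> \<omega> \<in> B (before I (labels \<omega>))"
      unfolding coded_def B_def j_def mem_Collect_eq
      by (rule R.sampled_eq_iff[OF trans_before irrefl_before I sub])
    moreover have "before I (labels \<omega>) \<in> ?R" using sub by blast
    ultimately show "\<omega> \<in> {\<omega>. \<forall>u\<in>I. coded I \<omega> u = x u} \<longleftrightarrow> \<omega> \<in> (\<Union>r\<in>?R. E r \<inter> B r)"
      by (auto simp: E_def)
  qed
  also have "measure Z.noise \<dots> = (\<Sum>r\<in>?R. measure Z.noise (E r \<inter> B r))"
    using E B I by (intro Z.N.finite_measure_finite_Union) (auto simp: disjoint_family_on_def E_def)
  also have "\<dots> = (\<Sum>r\<in>?R. measure Z.noise (E r) * measure P (cyl I x))"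
  proof (rule sum.cong[OF refl])
    fix r
    show "measure Z.noise (E r \<inter> B r) = measure Z.noise (E r) * measure P (cyl I x)"
    proof (cases "measure Z.noise (E r) = 0")
      case True
      have "measure Z.noise (E r \<inter> B r) \<le> measure Z.noise (E r)"
        using E by (intro Z.N.finite_measure_mono) auto
      then show ?thesis using True measure_nonneg[of Z.noise "E r \<inter> B r"] by simp
    next
      case False
      \<comment> \<open>An order of positive probability is realised by some configuration without
        ties, and this witness shows that \<open>r\<close> is total on \<open>I\<close>, as
        \<open>chain_rule\<close> requires.\<close>
      have "\<exists>\<omega>\<in>E r. \<forall>u v. u \<noteq> v \<longrightarrow> labels \<omega> u \<noteq> labels \<omega> v"
      proof (rule ccontr)
        assume "\<not> ?thesis"
        then have "AE \<omega> in Z.noise. \<omega> \<notin> E r"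
          using AE_no_ties by (auto elim!: eventually_mono)
        then have "measure Z.noise (E r) = 0"
          using E by (simp add: Z.N.prob_eq_0)
        with False show False by simp
      qed
      then obtain \<omega> where r: "r = before I (labels \<omega>)" and inj: "\<And>u v. u \<noteq> v \<Longrightarrow> labels \<omega> u \<noteq> labels \<omega> v"
        by (auto simp: E_def)
      have rI: "r \<subseteq> I \<times> I" using sub r by simp
      have fin: "finite (cluster r u - {u})" if "u \<in> I" for u
      proof -
        have "cluster r u \<subseteq> I" using that rI cluster_rel by blast
        then show ?thesis using I by (simp add: finite_subset)
      qed
      have "measure Z.noise (E r \<inter> B r)
          = measure Z.noise (E r) * (\<Prod>u\<in>I. measure (digit_law (2 * j r u + 1)) {x u})"
        unfolding E_def B_def by (rule Z.label_sample_indep[OF I])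
      also have "(\<Prod>u\<in>I. measure (digit_law (2 * j r u + 1)) {x u})
          = (\<Prod>u\<in>I. measure (cond_law u (cluster r u - {u}) x) {x u})"
        using fin by (intro prod.cong refl) (simp only: j_def digit_law_index)
      also have "\<dots> = measure P (cyl I x)"
      proof (rule chain_rule)
        show "trans r" unfolding r by (rule trans_before)
        show "irrefl r" unfolding r by (rule irrefl_before)
        show "(u, v) \<in> r \<or> (v, u) \<in> r" if "u \<in> I" "v \<in> I" "u \<noteq> v" for u v
          unfolding r using that inj by (intro before_total) auto
      qed (use I rI in auto)
      finally show ?thesis .
    qed
  qed
  also have "\<dots> = (\<Sum>r\<in>?R. measure Z.noise (E r)) * measure P (cyl I x)"
    by (simp add: sum_distrib_right)
  also have "(\<Sum>r\<in>?R. measure Z.noise (E r)) = measure Z.noise (\<Union>r\<in>?R. E r)"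
    using E I by (intro Z.N.finite_measure_finite_Union[symmetric]) (auto simp: disjoint_family_on_def E_def)
  also have "(\<Union>r\<in>?R. E r) = space Z.noise"
    using sub by (auto simp: E_def Z.space_noise)
  finally show ?thesis by (simp add: Z.N.prob_space)
qed

text \<open>On a finite window the configurations are countable, so equality at single points gives
  equality of laws and hence of rectangle probabilities.\<close>

lemma prob_coded_window:
  assumes I: "finite I" and "J \<subseteq> I"
  shows "measure Z.noise {\<omega>. \<forall>u\<in>J. coded I \<omega> u \<in> A u} = measure P {z. \<forall>u\<in>J. z u \<in> A u}"
proof -
  let ?C = "count_space (PiE I (\<lambda>_. UNIV :: nat set))"
  have C: "countable (PiE I (\<lambda>_. UNIV :: nat set))" using I by (intro countable_PiE) auto
  have eqC: "PiM I (\<lambda>_. count_space (UNIV :: nat set)) = ?C"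
    using I by (intro count_space_PiM_finite) auto
  have f: "(\<lambda>\<omega>. restrict (coded I \<omega>) I) \<in> measurable Z.noise ?C"
    unfolding eqC[symmetric] by (intro measurable_restrict measurable_coded)
  have h: "(\<lambda>z. restrict z I) \<in> measurable P ?C"
    unfolding eqC[symmetric] by (intro measurable_restrict coordinate_measurable)
  have eq: "distr Z.noise ?C (\<lambda>\<omega>. restrict (coded I \<omega>) I) = distr P ?C (\<lambda>z. restrict z I)"
  proof (rule measure_eqI_countable[where A = "PiE I (\<lambda>_. UNIV)"])
    fix x assume x: "x \<in> PiE I (\<lambda>_. UNIV :: nat set)"
    have rx: "restrict y I = x \<longleftrightarrow> (\<forall>u\<in>I. y u = x u)" for y :: "int \<Rightarrow> nat"
    proof
      assume "\<forall>u\<in>I. y u = x u"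
      then have "restrict y I = restrict x I" by (intro restrict_ext) auto
      also have "\<dots> = x" using x by (rule PiE_restrict)
      finally show "restrict y I = x" .
    qed auto
    have "(\<lambda>\<omega>. restrict (coded I \<omega>) I) -` {x} \<inter> space Z.noise = {\<omega>. \<forall>u\<in>I. coded I \<omega> u = x u}"
      by (auto simp: Z.space_noise rx)
    moreover have "(\<lambda>z. restrict z I) -` {x} \<inter> space P = cyl I x"
      by (auto simp: space_P rx cyl_def)
    ultimately show "emeasure (distr Z.noise ?C (\<lambda>\<omega>. restrict (coded I \<omega>) I)) {x}
        = emeasure (distr P ?C (\<lambda>z. restrict z I)) {x}"
      using x prob_coded_cyl[OF I, of x]
      by (simp add: emeasure_distr[OF f] emeasure_distr[OF h] emeasure_eq_measure Z.N.emeasure_eq_measure)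
  qed (use C in auto)
  let ?S = "{z \<in> PiE I (\<lambda>_. UNIV :: nat set). \<forall>u\<in>J. z u \<in> A u}"
  have "measure (distr Z.noise ?C (\<lambda>\<omega>. restrict (coded I \<omega>) I)) ?S = measure (distr P ?C (\<lambda>z. restrict z I)) ?S"
    by (simp only: eq)
  moreover have "(\<lambda>\<omega>. restrict (coded I \<omega>) I) -` ?S \<inter> space Z.noise = {\<omega>. \<forall>u\<in>J. coded I \<omega> u \<in> A u}"
    using assms(2) by (auto simp: Z.space_noise subset_iff)
  moreover have "(\<lambda>z. restrict z I) -` ?S \<inter> space P = {z. \<forall>u\<in>J. z u \<in> A u}"
    using assms(2) by (auto simp: space_P subset_iff)
  ultimately show ?thesis
    by (simp add: measure_distr[OF f] measure_distr[OF h])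
qed

text \<open>The window consists of the sites within distance \<open>n\<close> of \<open>J\<close>.
  Off \<open>Bad\<close> the windowed and the full field agree on \<open>J\<close>, and the windowed
  probability is exactly \<open>?p\<close> for each \<open>n\<close>, so only the vanishing
  probability of \<open>Bad\<close> separates the two sides.\<close>

lemma prob_coded_rectangle:
  assumes J: "finite J"
  shows "measure Z.noise {\<omega>. \<forall>u\<in>J. coded UNIV \<omega> u \<in> A u} = measure P {z. \<forall>u\<in>J. z u \<in> A u}"
    (is "measure _ ?U = ?p")
proof -
  have sets: "{\<omega>. \<forall>u\<in>J. coded I \<omega> u \<in> A u} \<in> sets Z.noise" for I
  proof -
    have "Measurable.pred Z.noise (\<lambda>\<omega>. \<forall>u. u \<in> J \<longrightarrow> coded I \<omega> u \<in> A u)" by measurable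
    then show ?thesis by (simp add: pred_def Z.space_noise Ball_def)
  qed
  have "\<bar>measure Z.noise ?U - ?p\<bar> \<le> real (card J) * (2 / real (n + 1))" for n
  proof -
    define I where "I = (\<Union>v\<in>J. {v - int n..v + int n})"
    define Bad where "Bad = (\<Union>v\<in>J. unblocked v n)"
    let ?W = "{\<omega>. \<forall>u\<in>J. coded I \<omega> u \<in> A u}"
    have I: "finite I" "J \<subseteq> I" using J by (force simp: I_def)+
    have Bad: "Bad \<in> sets Z.noise" unfolding Bad_def using J by auto
    have "coded I \<omega> v = coded UNIV \<omega> v" if "\<omega> \<notin> Bad" "v \<in> J" for \<omega> v
    proof (rule coded_window[OF I(1)])
      have "\<omega> \<notin> unblocked v n" using that by (auto simp: Bad_def)
      then show "cluster (before UNIV (labels \<omega>)) v \<subseteq> I"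
        using cluster_subset_window[of \<omega> v n UNIV] that(2) by (fastforce simp: I_def)
    qed
    then have sub: "?U \<subseteq> ?W \<union> Bad" "?W \<subseteq> ?U \<union> Bad" by auto
    have "measure Z.noise ?U \<le> measure Z.noise (?W \<union> Bad)"
      using sub(1) sets Bad by (intro Z.N.finite_measure_mono) auto
    also have "\<dots> \<le> measure Z.noise ?W + measure Z.noise Bad"
      using sets Bad by (rule measure_Un_le)
    finally have 1: "measure Z.noise ?U \<le> measure Z.noise ?W + measure Z.noise Bad" .
    have "measure Z.noise ?W \<le> measure Z.noise (?U \<union> Bad)"
      using sub(2) sets Bad by (intro Z.N.finite_measure_mono) auto
    also have "\<dots> \<le> measure Z.noise ?U + measure Z.noise Bad"
      using sets Bad by (rule measure_Un_le)
    finally have 2: "measure Z.noise ?W \<le> measure Z.noise ?U + measure Z.noise Bad" .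
    have "measure Z.noise Bad \<le> (\<Sum>v\<in>J. measure Z.noise (unblocked v n))"
      unfolding Bad_def using J by (intro measure_UNION_le) auto
    also have "\<dots> \<le> (\<Sum>v\<in>J. 2 / real (n + 1))"
      by (intro sum_mono Z.prob_unblocked)
    finally have "measure Z.noise Bad \<le> real (card J) * (2 / real (n + 1))" by simp
    moreover have "measure Z.noise ?W = ?p" by (rule prob_coded_window[OF I])
    ultimately show ?thesis using 1 2 by linarith
  qed
  moreover have "(\<lambda>n. real (card J) * (2 / real (n + 1))) \<longlonglongrightarrow> 0" by real_asymp
  ultimately have "\<bar>measure Z.noise ?U - ?p\<bar> \<le> 0"
    by (intro LIMSEQ_le_const[of _ 0]) auto
  then show ?thesis by simp
qed

lemma distr_coded: "distr Z.noise (Pi\<^sub>M UNIV (\<lambda>_. count_space UNIV)) (coded UNIV) = P"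
proof (rule measure_eqI_PiM_infinite)
  have meas: "coded UNIV \<in> measurable Z.noise (Pi\<^sub>M UNIV (\<lambda>_. count_space UNIV))"
    by (rule measurable_PiM_single'[of _ "\<lambda>v \<omega>. coded UNIV \<omega> v"]) auto
  interpret D: prob_space "distr Z.noise (Pi\<^sub>M UNIV (\<lambda>_. count_space UNIV)) (coded UNIV)"
    by (rule Z.N.prob_space_distr[OF meas])
  show "finite_measure (distr Z.noise (Pi\<^sub>M UNIV (\<lambda>_. count_space UNIV)) (coded UNIV))"
    by unfold_locales
  fix A :: "int \<Rightarrow> nat set" and J :: "int set" assume J: "finite J"
  let ?S = "prod_emb UNIV (\<lambda>_. count_space UNIV) J (Pi\<^sub>E J A)"
  have S: "?S = {z. \<forall>u\<in>J. z u \<in> A u}"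
    by (auto simp: prod_emb_def space_PiM PiE_iff)
  have "?S \<in> sets (Pi\<^sub>M UNIV (\<lambda>_. count_space UNIV))"
    using J by (intro sets_PiM_I) auto
  then have "emeasure (distr Z.noise (Pi\<^sub>M UNIV (\<lambda>_. count_space UNIV)) (coded UNIV)) ?S
      = emeasure Z.noise {\<omega>. \<forall>u\<in>J. coded UNIV \<omega> u \<in> A u}"
    by (simp add: emeasure_distr[OF meas] S Z.space_noise vimage_def)
  also have "\<dots> = emeasure P ?S"
    using prob_coded_rectangle[OF J] by (simp add: S emeasure_eq_measure Z.N.emeasure_eq_measure)
  finally show "emeasure (distr Z.noise (Pi\<^sub>M UNIV (\<lambda>_. count_space UNIV)) (coded UNIV)) ?S = emeasure P ?S" .
qed (simp_all add: sets_P)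

end

section \<open>The coding radius\<close>

lemma less_fun_first_difference:
  assumes "f d \<noteq> g d" "\<And>k. k < d \<Longrightarrow> f k = g k"
  shows "less_fun f g \<longleftrightarrow> f d < g d"
proof
  assume "less_fun f g"
  then obtain k where k: "f k < g k" "\<And>j. j < k \<Longrightarrow> f j = g j"
    unfolding less_fun_def by blast
  have "k = d"
    using k assms by (cases k d rule: linorder_cases) auto
  then show "f d < g d" using k by simp
next
  assume "f d < g d"
  then show "less_fun f g" using assms(2) by (auto simp: less_fun_def)
qed

lemma finite_nat_bound:
  assumes "finite (S :: nat set)"
  obtains n where "\<And>k. k \<in> S \<Longrightarrow> k < n"
proof -
  obtain n where "\<forall>k\<in>S. k < n" using assms finite_nat_set_iff_bounded by auto
  then show ?thesis using that by blast
qed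

context one_dependent_law
begin

text \<open>On the event in question finitely many label digits decide all comparisons in the window,
  hence the cluster of every site in the cluster of \<open>0\<close>.\<close>

lemma coded_finitely_determined:
  assumes "\<omega> \<notin> unblocked 0 r" and inj: "\<And>u v. u \<noteq> v \<Longrightarrow> labels \<omega> u \<noteq> labels \<omega> v"
  obtains n where "\<And>\<omega>'. (\<And>v k. \<bar>v\<bar> \<le> int r \<Longrightarrow> k < n \<Longrightarrow> \<omega>' v k = \<omega> v k) \<Longrightarrow> coded UNIV \<omega>' 0 = coded UNIV \<omega> 0"
proof -
  define cl where "cl \<omega> = cluster (before UNIV (labels \<omega>))" for \<omega>
  define d where "d u v = (LEAST k. labels \<omega> u k \<noteq> labels \<omega> v k)" for u v
  define e where "e u = 2 * law_index u (cl \<omega> u - {u}) (coded UNIV \<omega>) + 1" for u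
  let ?I = "{- int r..int r}"
  \<comment> \<open>\<open>n\<close> exceeds the positions of two kinds of digits: the first label
    digit in which two sites of the window differ, and the one sample that each site of the window
    would read.\<close>
  obtain n where n: "\<And>k. k \<in> (\<lambda>(u, v). 2 * d u v) ` (?I \<times> ?I) \<union> e ` ?I \<Longrightarrow> k < n"
    by (rule finite_nat_bound[of "(\<lambda>(u, v). 2 * d u v) ` (?I \<times> ?I) \<union> e ` ?I"]) auto
  have nd: "2 * d u v < n" if "u \<in> ?I" "v \<in> ?I" for u v using n that by blast
  have ne: "e u < n" if "u \<in> ?I" for u using n that by blast
  have d: "labels \<omega> u (d u v) \<noteq> labels \<omega> v (d u v)" "\<And>k. k < d u v \<Longrightarrow> labels \<omega> u k = labels \<omega> v k"
    if "u \<noteq> v" for u v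
  proof -
    have "\<exists>k. labels \<omega> u k \<noteq> labels \<omega> v k" using inj[OF that] by (auto simp: fun_eq_iff)
    then show "labels \<omega> u (d u v) \<noteq> labels \<omega> v (d u v)" unfolding d_def by (rule LeastI_ex)
    show "labels \<omega> u k = labels \<omega> v k" if "k < d u v" for k
      using not_less_Least[OF that[unfolded d_def]] by simp
  qed
  obtain a b where ab: "a < 0" "0 < b" "- int r \<le> a" "b \<le> int r"
    "\<not> less_fun (labels \<omega> a) (labels \<omega> 0)" "\<not> less_fun (labels \<omega> b) (labels \<omega> 0)"
    using blocked_cluster[OF assms(1)] by auto
  have "coded UNIV \<omega>' 0 = coded UNIV \<omega> 0"
    if agree: "\<And>v k. \<bar>v\<bar> \<le> int r \<Longrightarrow> k < n \<Longrightarrow> \<omega>' v k = \<omega> v k" for \<omega>'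
  proof -
    have lab: "labels \<omega>' u k = labels \<omega> u k" if "u \<in> ?I" "2 * k < n" for u k
      using agree[of u "2 * k"] that by (auto simp: labels_def)
    have less_iff: "less_fun (labels \<omega>' u) (labels \<omega>' v) \<longleftrightarrow> less_fun (labels \<omega> u) (labels \<omega> v)"
      if uv: "u \<in> ?I" "v \<in> ?I" for u v
    proof (cases "u = v")
      case False
      have lo: "labels \<omega>' u k = labels \<omega> u k" "labels \<omega>' v k = labels \<omega> v k" if "k \<le> d u v" for k
        using lab[of _ k] nd[OF uv] that uv by auto
      have "less_fun (labels \<omega>' u) (labels \<omega>' v) \<longleftrightarrow> labels \<omega>' u (d u v) < labels \<omega>' v (d u v)"
        using d[OF False] lo by (intro less_fun_first_difference) auto
      also have "\<dots> \<longleftrightarrow> labels \<omega> u (d u v) < labels \<omega> v (d u v)" using lo by simp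
      also have "\<dots> \<longleftrightarrow> less_fun (labels \<omega> u) (labels \<omega> v)"
        using d[OF False] by (intro less_fun_first_difference[symmetric]) auto
      finally show ?thesis .
    qed (simp add: less_fun_irrefl)
    have sub0: "cl \<omega> 0 \<subseteq> {a<..<b}"
      unfolding cl_def using ab by (intro cluster_between) auto
    have cl_eq: "cl \<omega>' u = cl \<omega> u" if u: "u \<in> cl \<omega> 0" for u
    proof -
      have uab: "a < u" "u < b" using sub0 u by auto
      have I: "{a..b} \<subseteq> ?I" using ab by auto
      have "less_fun (labels \<omega> u) (labels \<omega> 0) \<or> u = 0"
        using u cluster_rel[of u _ 0] by (auto simp: cl_def before_def)
      \<comment> \<open>Barriers of 0 are barriers for each \<open>u\<close> in its cluster, since
        the label of \<open>u\<close> is at most that of 0. Being at comparable positions in the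
        window, they survive the change to \<open>\<omega>'\<close>, which keeps the new clusters
        from escaping.\<close>
      then have not: "\<not> less_fun (labels \<omega> a) (labels \<omega> u)" "\<not> less_fun (labels \<omega> b) (labels \<omega> u)"
        using ab(5,6) less_fun_trans by blast+
      then have not': "\<not> less_fun (labels \<omega>' a) (labels \<omega>' u)" "\<not> less_fun (labels \<omega>' b) (labels \<omega>' u)"
        using less_iff[of _ u] uab I by (auto simp: subset_iff)
      have s: "cl \<omega> u \<subseteq> {a<..<b}" unfolding cl_def by (rule cluster_between[OF uab not])
      have s': "cl \<omega>' u \<subseteq> {a<..<b}" unfolding cl_def by (rule cluster_between[OF uab not'])
      have "z \<in> cl \<omega>' u \<longleftrightarrow> z \<in> cl \<omega> u" if z: "z \<in> {a<..<b}" for z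
      proof -
        have "{min z u..max z u} \<subseteq> ?I" "u \<in> ?I" using z uab ab by auto
        then have "less_fun (labels \<omega>' w) (labels \<omega>' u) \<longleftrightarrow> less_fun (labels \<omega> w) (labels \<omega> u)"
          if "w \<in> {min z u..max z u}" for w using that by (intro less_iff) auto
        then show ?thesis unfolding cl_def cluster_def before_def by simp
      qed
      then show ?thesis using s s' by blast
    qed
    show ?thesis
      unfolding coded_def
    proof (rule R.sampled_local)
      show "finite (cluster (before UNIV (labels \<omega>)) 0)"
        using sub0 finite_subset by (fastforce simp: cl_def)
      fix u assume u: "u \<in> cluster (before UNIV (labels \<omega>)) 0"
      then show "cluster (before UNIV (labels \<omega>')) u = cluster (before UNIV (labels \<omega>)) u"
        using cl_eq by (simp add: cl_def)
      have uI: "u \<in> ?I" using u sub0 ab by (auto simp: cl_def)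
      then have "\<omega>' u (e u) = \<omega> u (e u)" using ne agree by auto
      then show "samples \<omega>' u (law_index u (cluster (before UNIV (labels \<omega>)) u - {u})
              (sampled law_index (before UNIV (labels \<omega>)) (samples \<omega>)))
          = samples \<omega> u (law_index u (cluster (before UNIV (labels \<omega>)) u - {u})
              (sampled law_index (before UNIV (labels \<omega>)) (samples \<omega>)))"
        by (simp add: samples_def e_def cl_def coded_def)
    qed (rule trans_before irrefl_before)+
  qed
  then show ?thesis using that by blast
qed

lemma coded_equivariant:
  assumes \<gamma>: "graph_automorphism \<gamma>"
    and inv: "\<And>K x. finite K \<Longrightarrow> measure P (cyl K (\<lambda>i. x (\<gamma> i))) = measure P (cyl (\<gamma> ` K) x)"
  shows "coded UNIV (\<lambda>i. \<omega> (\<gamma> i)) v = coded UNIV \<omega> (\<gamma> v)"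
proof -
  have "inj \<gamma>" using \<gamma> by (auto simp: graph_automorphism_def bij_is_inj)
  have lab: "labels (\<lambda>i. \<omega> (\<gamma> i)) u = labels \<omega> (\<gamma> u)" for u by (simp add: labels_def fun_eq_iff)
  have sam: "samples (\<lambda>i. \<omega> (\<gamma> i)) = (\<lambda>i. samples \<omega> (\<gamma> i))" by (simp add: samples_def fun_eq_iff)
  show ?thesis
    unfolding coded_def sam
  proof (rule sampled_equivariant[OF \<gamma>])
    show "(u, w) \<in> before UNIV (labels (\<lambda>i. \<omega> (\<gamma> i))) \<longleftrightarrow> (\<gamma> u, \<gamma> w) \<in> before UNIV (labels \<omega>)" for u w
      by (simp add: before_def lab)
    show "law_index v K (\<lambda>i. x (\<gamma> i)) = law_index (\<gamma> v) (\<gamma> ` K) x" if "finite K" for v K x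
      unfolding law_index_def by (subst cond_law_invariant[OF that \<open>inj \<gamma>\<close> inv]) auto
  qed
qed

end

section \<open>Binary encoding and the coding\<close>

text \<open>One-hot code: after pairing, row \<open>i\<close> is the indicator of the single value
  \<open>f i\<close>. Unbounded digits thus become a point of a product of two-element sets.\<close>

definition encode :: "(nat \<Rightarrow> nat) \<Rightarrow> nat \<Rightarrow> nat" where
  "encode f k = (if f (fst (prod_decode k)) = snd (prod_decode k) then 1 else 0)"

text \<open>Total on all bit sequences; a row without a 1 decodes to whatever fixed number
  \<open>LEAST\<close> returns there.\<close>

definition decode :: "(nat \<Rightarrow> nat) \<Rightarrow> nat \<Rightarrow> nat" where
  "decode y i = (LEAST m. y (prod_encode (i, m)) = 1)"

abbreviation bits :: "(nat \<Rightarrow> nat) measure" where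
  "bits \<equiv> Pi\<^sub>M UNIV (\<lambda>_. count_space {0, 1})"

text \<open>The bits of row \<open>i\<close> up to position \<open>f i\<close> already determine the
  value. This finiteness keeps the coding finitary, and \<open>y\<close> itself need not be a code
  word.\<close>

lemma decode_agree:
  assumes "\<And>m. m \<le> f i \<Longrightarrow> y (prod_encode (i, m)) = encode f (prod_encode (i, m))"
  shows "decode y i = f i"
  unfolding decode_def
proof (rule Least_equality)
  show "y (prod_encode (i, f i)) = 1" using assms[of "f i"] by (simp add: encode_def)
  show "f i \<le> m" if y: "y (prod_encode (i, m)) = 1" for m
  proof (rule ccontr)
    assume "\<not> f i \<le> m"
    then have "y (prod_encode (i, m)) = 0" using assms[of m] by (simp add: encode_def)
    then show False using y by simp
  qed
qed

lemma decode_encode: "decode (encode f) = f"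
  by (rule ext) (rule decode_agree, simp)

lemma measurable_decode: "(\<lambda>y. decode y i) \<in> measurable bits (count_space UNIV)"
proof -
  have [measurable]: "Measurable.pred bits (\<lambda>y. y k = 1)" for k
    by measurable
  show ?thesis unfolding decode_def by measurable
qed

lemma (in noise) measurable_encode: "encode \<in> measurable (Pi\<^sub>M UNIV q) bits"
proof (rule measurable_PiM_single'[of _ "\<lambda>k f. encode f k"])
  show "(\<lambda>f. encode f k) \<in> measurable (Pi\<^sub>M UNIV q) (count_space {0, 1})" for k
    unfolding encode_def by (rule measurable_compose[OF measurable_site]) simp
qed (auto simp: encode_def split: if_splits)

lemma (in noise) iid_encode: "iid_process noise bits (\<lambda>v \<omega>. encode (\<omega> v))"
proof -
  have meas: "(\<lambda>\<omega>. encode (\<omega> v)) \<in> measurable noise bits" for v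
    by (rule measurable_compose[OF measurable_noise measurable_encode])
  have site: "distr noise (Pi\<^sub>M UNIV q) (\<lambda>\<omega>. \<omega> v) = Pi\<^sub>M UNIV q" for v
    unfolding noise_def by (rule field.PiM_component) simp
  have "distr noise noise (\<lambda>\<omega>. \<omega>) = noise" by (rule distr_id2) simp
  then have "N.indep_vars (\<lambda>_. Pi\<^sub>M UNIV q) (\<lambda>v \<omega>. \<omega> v) UNIV"
    by (subst N.indep_vars_iff_distr_eq_PiM) (simp_all add: site noise_def[symmetric] restrict_def)
  then have "N.indep_vars (\<lambda>_. bits) (\<lambda>v. encode \<circ> (\<lambda>\<omega>. \<omega> v)) UNIV"
    by (rule N.indep_vars_compose) (rule measurable_encode)
  moreover have "distr noise bits (\<lambda>\<omega>. encode (\<omega> v)) = distr (Pi\<^sub>M UNIV q) bits encode" for v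
    using distr_distr[OF measurable_encode measurable_noise[of v]] by (simp add: site comp_def)
  ultimately show ?thesis
    using meas N.prob_space_axioms by (simp add: iid_process_def random_field_def comp_def)
qed

section \<open>Transfer to natural-number values, the coding and its radius\<close>

theorem mainTheorem4:
  fixes \<Gamma> :: "(int \<Rightarrow> int) set" and S :: "'s set"
    and M :: "'w measure" and X :: "int \<Rightarrow> 'w \<Rightarrow> 's"
  assumes "automorphism_group \<Gamma>"
    and "acts_transitively \<Gamma>"
    and "countable S"
    and "random_field M (count_space S) X"
    and "invariant_field \<Gamma> M (count_space S) X"
    and "one_dependent M (count_space S) X"
  shows "finitary_iid_factor_with_tail \<Gamma> M (count_space S) X (\<lambda>r. 8 / real r)"
proof -
  interpret M: prob_space M using assms(4) by (simp add: random_field_def)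
  have X [measurable]: "X i \<in> measurable M (count_space S)" for i
    using assms(4) by (simp add: random_field_def)
  have XS: "X i \<omega> \<in> S" if "\<omega> \<in> space M" for i \<omega>
    using measurable_space[OF X that] by simp
  have "S \<noteq> {}" using XS M.not_empty by blast
  define num where "num = to_nat_on S"
  define val where "val = from_nat_into S"
  have val_num: "val (num s) = s" if "s \<in> S" for s
    using that assms(3) by (simp add: num_def val_def)
  have val_S: "val n \<in> S" for n
    using from_nat_into[OF \<open>S \<noteq> {}\<close>] by (simp add: val_def)
  let ?C = "Pi\<^sub>M (UNIV :: int set) (\<lambda>_. count_space (UNIV :: nat set))"
  \<comment> \<open>The values in \<open>S\<close> are numbered, so that the construction runs on
    laws of natural-number fields; \<open>val\<close> translates back at the end.\<close>
  define P where "P = distr M ?C (\<lambda>\<omega> i. num (X i \<omega>))"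
  have "(\<lambda>\<omega>. num (X i \<omega>)) \<in> measurable M (count_space UNIV)" for i
    by (rule measurable_compose[OF X]) simp
  then have numX: "(\<lambda>\<omega> i. num (X i \<omega>)) \<in> measurable M ?C"
    by (rule measurable_PiM_single'[of _ "\<lambda>i \<omega>. num (X i \<omega>)"]) auto
  have "Measurable.pred ?C (\<lambda>z. \<forall>i. i \<in> K \<longrightarrow> z i = x i)" for K and x :: "int \<Rightarrow> nat"
    by measurable
  then have cyl: "cyl K x \<in> sets ?C" for K x
    by (simp add: cyl_def pred_def space_PiM Ball_def)
  have P_cyl: "measure P (cyl K x) = measure M {\<omega> \<in> space M. \<forall>i\<in>K. num (X i \<omega>) = x i}" for K x
    unfolding P_def measure_distr[OF numX cyl] by (rule arg_cong[where f = "measure M"]) (auto simp: cyl_def)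
  interpret P: prob_space P unfolding P_def by (rule M.prob_space_distr[OF numX])
  interpret L: one_dependent_law P
  proof
    show "sets P = sets ?C" by (simp add: P_def)
    fix A B :: "int set" and x :: "int \<Rightarrow> nat"
    assume AB: "finite A" "finite B" "\<forall>i\<in>A. \<forall>j\<in>B. \<bar>i - j\<bar> > 1"
    define E where "E K = {z \<in> space (Pi\<^sub>M K (\<lambda>_. count_space S)). \<forall>i\<in>K. num (z i) = x i}" for K
    have E: "E K \<in> sets (Pi\<^sub>M K (\<lambda>_. count_space S))" if [simp]: "finite K" for K
    proof -
      have "(\<lambda>z. num (z i)) \<in> measurable (Pi\<^sub>M K (\<lambda>_. count_space S)) (count_space UNIV)" if "i \<in> K" for i
        by (rule measurable_compose[OF measurable_component_singleton[OF that]]) simp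
      then have "Measurable.pred (Pi\<^sub>M K (\<lambda>_. count_space S)) (\<lambda>z. \<forall>i\<in>K. num (z i) = x i)"
        by measurable
      then show ?thesis by (simp add: E_def pred_def)
    qed
    have pre: "(\<lambda>\<omega>. \<lambda>i\<in>K. X i \<omega>) -` E K \<inter> space M = {\<omega> \<in> space M. \<forall>i\<in>K. num (X i \<omega>) = x i}" for K
      by (auto simp: E_def space_PiM XS)
    have "M.indep_var (Pi\<^sub>M A (\<lambda>_. count_space S)) (\<lambda>\<omega>. \<lambda>i\<in>A. X i \<omega>)
        (Pi\<^sub>M B (\<lambda>_. count_space S)) (\<lambda>\<omega>. \<lambda>j\<in>B. X j \<omega>)"
      using assms(6) AB(3) by (simp add: one_dependent_def)
    from M.indep_varD[OF this E[OF AB(1)] E[OF AB(2)]]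
    have "measure M ((\<lambda>\<omega>. (\<lambda>i\<in>A. X i \<omega>, \<lambda>j\<in>B. X j \<omega>)) -` (E A \<times> E B) \<inter> space M)
        = measure P (cyl A x) * measure P (cyl B x)"
      by (simp add: pre P_cyl)
    moreover have "(\<lambda>\<omega>. (\<lambda>i\<in>A. X i \<omega>, \<lambda>j\<in>B. X j \<omega>)) -` (E A \<times> E B) \<inter> space M
        = ((\<lambda>\<omega>. \<lambda>i\<in>A. X i \<omega>) -` E A \<inter> space M) \<inter> ((\<lambda>\<omega>. \<lambda>j\<in>B. X j \<omega>) -` E B \<inter> space M)"
      by blast
    moreover have "\<dots> = {\<omega> \<in> space M. \<forall>i\<in>A \<union> B. num (X i \<omega>) = x i}"
      unfolding pre by blast
    ultimately show "measure P (cyl (A \<union> B) x) = measure P (cyl A x) * measure P (cyl B x)"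
      by (simp add: P_cyl)
  qed
  have inv: "measure P (cyl K (\<lambda>i. x (\<gamma> i))) = measure P (cyl (\<gamma> ` K) x)" if "\<gamma> \<in> \<Gamma>" for \<gamma> K x
  proof -
    let ?A = "configs (count_space S)"
    let ?E = "{z \<in> space ?A. \<forall>i. i \<in> K \<longrightarrow> num (z i) = x (\<gamma> i)}"
    have "Measurable.pred ?A (\<lambda>z. \<forall>i. i \<in> K \<longrightarrow> num (z i) = x (\<gamma> i))"
      by measurable
    then have E: "?E \<in> sets ?A" by (simp add: pred_def)
    have f: "(\<lambda>\<omega> i. X (\<sigma> i) \<omega>) \<in> measurable M ?A" for \<sigma>
      by (rule measurable_PiM_single'[of _ "\<lambda>i. X (\<sigma> i)"]) (auto simp: XS)
    have m: "measure (field_law M (count_space S) (\<lambda>i. X (\<sigma> i))) ?E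
        = measure M {\<omega> \<in> space M. \<forall>i\<in>K. num (X (\<sigma> i) \<omega>) = x (\<gamma> i)}" for \<sigma>
      unfolding field_law_def measure_distr[OF f E]
      by (rule arg_cong[where f = "measure M"]) (auto simp: space_PiM XS)
    have "field_law M (count_space S) (\<lambda>i. X (\<gamma> i)) = field_law M (count_space S) X"
      using assms(5) that by (simp add: invariant_field_def)
    then show ?thesis
      \<comment> \<open>The identity gives the cylinder over \<open>K\<close>;
        \<open>\<gamma>\<close> gives the one over its image, with the quantifier over the image
        reindexed by \<open>K\<close>.\<close>
      using m[of \<gamma>] m[of "\<lambda>i. i"] by (simp add: P_cyl)
  qed
  define \<phi> where "\<phi> y = (\<lambda>v. val (L.coded UNIV (\<lambda>u. decode (y u)) v))" for y
  have \<phi>_encode: "\<phi> (\<lambda>i. encode (\<omega> i)) = (\<lambda>v. val (L.coded UNIV \<omega> v))" for \<omega>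
    by (simp add: \<phi>_def decode_encode)
  have coding: "is_coding \<Gamma> L.Z.noise bits (\<lambda>v \<omega>. encode (\<omega> v)) M (count_space S) X \<phi>"
    unfolding is_coding_def
  proof (intro conjI ballI)
    have dec: "(\<lambda>y. decode (y u) k) \<in> measurable (configs bits) (count_space UNIV)" for u :: int and k
      by (rule measurable_compose[OF _ measurable_decode]) simp
    have "(\<lambda>y. L.coded UNIV (\<lambda>u. decode (y u)) v) \<in> measurable (configs bits) (count_space UNIV)" for v
      unfolding L.coded_def
      by (rule L.R.measurable_sampled; unfold labels_def samples_def; rule dec)
    then have "(\<lambda>y. \<phi> y v) \<in> measurable (configs bits) (count_space S)" for v
      unfolding \<phi>_def by (rule measurable_compose) (simp add: val_S)
    then show "\<phi> \<in> measurable (configs bits) (configs (count_space S))"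
      by (intro measurable_PiM_single'[of _ "\<lambda>v y. \<phi> y v"]) (auto simp: \<phi>_def val_S)
  next
    fix \<gamma> and y :: "int \<Rightarrow> nat \<Rightarrow> nat" assume \<gamma>: "\<gamma> \<in> \<Gamma>"
    then have "graph_automorphism \<gamma>" using assms(1) by (simp add: automorphism_group_def)
    from L.coded_equivariant[OF this inv[OF \<gamma>], of "\<lambda>u. decode (y u)"]
    show "\<phi> (\<lambda>i. y (\<gamma> i)) = (\<lambda>i. \<phi> y (\<gamma> i))" by (simp add: \<phi>_def)
  next
    have coded: "L.coded UNIV \<in> measurable L.Z.noise ?C"
      by (rule measurable_PiM_single'[of _ "\<lambda>v \<omega>. L.coded UNIV \<omega> v"]) auto
    have h: "(\<lambda>z v. val (z v)) \<in> measurable ?C (configs (count_space S))"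
    proof (rule measurable_PiM_single')
      show "(\<lambda>z. val (z v)) \<in> measurable ?C (count_space S)" for v
        by (rule measurable_compose[of "\<lambda>z. z v" _ "count_space UNIV"]) (simp_all add: val_S)
    qed (auto simp: val_S)
    have "distr L.Z.noise (configs (count_space S)) (\<lambda>\<omega>. \<phi> (\<lambda>i. encode (\<omega> i)))
        = distr (distr L.Z.noise ?C (L.coded UNIV)) (configs (count_space S)) (\<lambda>z v. val (z v))"
      by (simp add: \<phi>_encode distr_distr[OF h coded] comp_def)
    also have "\<dots> = distr M (configs (count_space S)) ((\<lambda>z v. val (z v)) \<circ> (\<lambda>\<omega> i. num (X i \<omega>)))"
      unfolding L.distr_coded by (simp add: P_def distr_distr[OF h numX])
    also have "\<dots> = field_law M (count_space S) X"
      unfolding field_law_def by (rule distr_cong) (simp_all add: val_num XS)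
    finally show "distr L.Z.noise (configs (count_space S)) (\<lambda>\<omega>. \<phi> (\<lambda>i. encode (\<omega> i)))
        = field_law M (count_space S) X" .
  qed
  let ?R = "\<lambda>\<omega>. product_coding_radius (\<lambda>_. {0, 1}) \<phi> (\<lambda>i. encode (\<omega> i))"
  have radius: "?R \<omega> \<le> enat r"
    if blocked: "\<omega> \<notin> unblocked 0 r" and inj: "\<forall>u v. u \<noteq> v \<longrightarrow> labels \<omega> u \<noteq> labels \<omega> v" for \<omega> r
  proof -
    obtain n where n: "\<And>\<omega>'. (\<And>v k. \<bar>v\<bar> \<le> int r \<Longrightarrow> k < n \<Longrightarrow> \<omega>' v k = \<omega> v k)
        \<Longrightarrow> L.coded UNIV \<omega>' 0 = L.coded UNIV \<omega> 0"
      using L.coded_finitely_determined[OF blocked] inj by blast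
    \<comment> \<open>All bits needed to read the first \<open>n\<close> digits at the sites of the
      window: in each row, those up to the position of its 1.\<close>
    define B where "B = (\<Union>v\<in>{- int r..int r}. \<Union>k<n. (\<lambda>m. prod_encode (k, m)) ` {..\<omega> v k})"
    have "finite B" unfolding B_def by (intro finite_UN_I finite_imageI) auto
    then obtain n' where n': "\<And>k. k \<in> B \<Longrightarrow> k < n'" by (rule finite_nat_bound) blast
    \<comment> \<open>The competitor \<open>y'\<close> is an arbitrary bit configuration, possibly
      outside the range of \<open>encode\<close>; agreement on \<open>B\<close> still forces the
      decoded digits.\<close>
    have "\<phi> y' 0 = \<phi> (\<lambda>i. encode (\<omega> i)) 0"
      if agree: "\<forall>v. \<bar>v\<bar> \<le> int r \<longrightarrow> (\<forall>k<n'. y' v k = encode (\<omega> v) k)" for y'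
    proof -
      have "decode (y' v) k = \<omega> v k" if "\<bar>v\<bar> \<le> int r" "k < n" for v k
      proof (rule decode_agree)
        fix m assume "m \<le> \<omega> v k"
        then have "prod_encode (k, m) \<in> B" using that by (force simp: B_def)
        then show "y' v (prod_encode (k, m)) = encode (\<omega> v) (prod_encode (k, m))"
          using n' agree that(1) by blast
      qed
      then have "L.coded UNIV (\<lambda>u. decode (y' u)) 0 = L.coded UNIV \<omega> 0" by (rule n)
      then show ?thesis unfolding \<phi>_encode by (simp add: \<phi>_def)
    qed
    then show ?thesis
      unfolding product_coding_radius_def by (intro Inf_lower) blast
  qed
  have "finitary_coding_with_tail \<Gamma> L.Z.noise bits (\<lambda>v \<omega>. encode (\<omega> v)) M (count_space S) X \<phi>
      (product_coding_radius (\<lambda>_. {0, 1}) \<phi>) (\<lambda>r. 8 / real r)"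
    unfolding finitary_coding_with_tail_def
  proof (intro conjI allI impI)
    show "AE \<omega> in L.Z.noise. ?R \<omega> < \<infinity>"
      using L.AE_no_ties L.Z.AE_blocked[of 0]
    proof eventually_elim
      case (elim \<omega>)
      then obtain r where "\<omega> \<notin> unblocked 0 r" by blast
      then have "?R \<omega> \<le> enat r" using elim(1) by (rule radius)
      also have "enat r < \<infinity>" by simp
      finally show ?case .
    qed
    fix r :: nat assume r: "1 \<le> r"
    let ?B = "{\<omega> \<in> space L.Z.noise. ?R \<omega> > enat r}"
    show "measure L.Z.noise ?B \<le> 8 / real r"
    \<comment> \<open>\<open>measure\<close> takes the value 0 on sets outside \<open>sets\<close>,
      which settles the second case.\<close>
    proof (cases "?B \<in> sets L.Z.noise")
      case True
      have "AE \<omega> in L.Z.noise. \<omega> \<in> ?B \<longrightarrow> \<omega> \<in> unblocked 0 r"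
        using L.AE_no_ties
      proof eventually_elim
        case (elim \<omega>)
        then show ?case using radius[of \<omega> r] by (auto simp: not_le[symmetric])
      qed
      then have "measure L.Z.noise ?B \<le> measure L.Z.noise (unblocked 0 r)"
        using True by (intro L.Z.N.finite_measure_mono_AE) auto
      also have "\<dots> \<le> 2 / real (r + 1)" by (rule L.Z.prob_unblocked)
      \<comment> \<open>The record bound 2/(r+1) has the smaller numerator and the larger
        denominator.\<close>
      also have "\<dots> \<le> 8 / real r" using r by (intro frac_le) auto
      finally show ?thesis .
    qed (simp add: measure_notin_sets)
  qed (rule coding)
  with L.Z.iid_encode show ?thesis
    unfolding finitary_iid_factor_with_tail_def
    by (intro disjI2 exI[of _ "\<lambda>_. {0, 1}"] exI[of _ L.Z.noise] exI[of _ "\<lambda>v \<omega>. encode (\<omega> v)"]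
        exI[of _ \<phi>] conjI) simp_all
qed

end
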